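(* For $v\in L^2_{\mathbb{C}}(0,1)$, if $\sigma(L_\alpha)=\sigma(L_0)$, then $v=0$.
   Context: Throughout, $\alpha\in\mathbb{R}$, and $\langle f,g\rangle=\int_0^1 f(x)\overline{g(x)}\,dx$ on $L^2_{\mathbb{C}}(0,1)$. The self-adjoint operator $L_\alpha=L_\alpha(v)$ in $L^2_{\mathbb{C}}(0,1)$ is $(L_\alpha y)(x)=\mathrm{i}y'''(x)+\alpha\langle y,v\rangle v(x)$ with domain $\{y\in W_3^2(0,1): y(1)=y(0),\ y'(1)=y'(0),\ y''(1)=y''(0)\}$, where $W_3^2(0,1)$ is the Sobolev space of functions with three derivatives in $L^2$; $L_0$ is the operator $L_0y=\mathrm{i}y'''$ with the same domain. $\sigma(\cdot)$ denotes the spectrum.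
   Formalization: The formal statement assumes α ≠ 0; for α = 0 the claim is false, since then L_α = L_0 for every v (for example v = 1), so equality of the spectra does not force v = 0. *)

theory Defs
  imports "HOL-Analysis.Analysis"
begin

(* Elements of L^2(0,1) are represented by square-integrable functions; equality of elements
   is equality almost everywhere with respect to unit_meas. *)

abbreviation unit_meas :: "real measure" where
  "unit_meas \<equiv> lebesgue_on {0<..<1}"

definition L2 :: "(real \<Rightarrow> complex) set" where
  "L2 = {f \<in> borel_measurable unit_meas. integrable unit_meas (\<lambda>x. (norm (f x))\<^sup>2)}"

definition ae_eq :: "(real \<Rightarrow> complex) \<Rightarrow> (real \<Rightarrow> complex) \<Rightarrow> bool" where
  "ae_eq f g \<longleftrightarrow> (AE x in unit_meas. f x = g x)"

definition ip :: "(real \<Rightarrow> complex) \<Rightarrow> (real \<Rightarrow> complex) \<Rightarrow> complex" where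
  "ip f g = (LINT x|unit_meas. f x * cnj (g x))"

definition L2norm :: "(real \<Rightarrow> complex) \<Rightarrow> real" where
  "L2norm f = sqrt (LINT x|unit_meas. (norm (f x))\<^sup>2)"

definition test_functions :: "(real \<Rightarrow> real) set" where
  "test_functions =
     {\<phi>. (\<forall>n x. (deriv ^^ n) \<phi> field_differentiable at x) \<and>
         (\<exists>a b. 0 < a \<and> b < 1 \<and> (\<forall>x. x \<notin> {a..b} \<longrightarrow> \<phi> x = 0))}"

definition is_weak_deriv :: "nat \<Rightarrow> (real \<Rightarrow> complex) \<Rightarrow> (real \<Rightarrow> complex) \<Rightarrow> bool" where
  "is_weak_deriv j y g \<longleftrightarrow>
     (\<forall>\<phi>\<in>test_functions.
        (LINT x|unit_meas. y x * complex_of_real ((deriv ^^ j) \<phi> x)) =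
        (-1) ^ j * (LINT x|unit_meas. g x * complex_of_real (\<phi> x)))"

definition sobolev :: "nat \<Rightarrow> (real \<Rightarrow> complex) set" where
  "sobolev k = {y \<in> L2. \<forall>j\<le>k. \<exists>g\<in>L2. is_weak_deriv j y g}"

(* A representative of the j-th weak derivative; it is unique up to null sets, and only
   meaningful when y has a j-th weak derivative in L^2(0,1). *)
definition weak_deriv :: "nat \<Rightarrow> (real \<Rightarrow> complex) \<Rightarrow> (real \<Rightarrow> complex)" where
  "weak_deriv j y = (SOME g. g \<in> L2 \<and> is_weak_deriv j y g)"

(* The boundary values of an element of L^2(0,1) are those of its representative that is
   continuous on the closed interval [0,1]; there is at most one such representative. *)
definition periodic_bc :: "(real \<Rightarrow> complex) \<Rightarrow> bool" where
  "periodic_bc u \<longleftrightarrow> (\<exists>w. continuous_on {0..1} w \<and> ae_eq u w \<and> w 1 = w 0)"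

definition dom_L :: "(real \<Rightarrow> complex) set" where
  "dom_L = {y \<in> sobolev 3. periodic_bc y \<and> periodic_bc (weak_deriv 1 y) \<and> periodic_bc (weak_deriv 2 y)}"

definition L_zero :: "(real \<Rightarrow> complex) \<Rightarrow> (real \<Rightarrow> complex)" where
  "L_zero y = (\<lambda>x. \<i> * weak_deriv 3 y x)"

definition L_op :: "real \<Rightarrow> (real \<Rightarrow> complex) \<Rightarrow> (real \<Rightarrow> complex) \<Rightarrow> (real \<Rightarrow> complex)" where
  "L_op \<alpha> v y = (\<lambda>x. \<i> * weak_deriv 3 y x + complex_of_real \<alpha> * ip y v * v x)"

(* T - z maps D bijectively onto L^2(0,1) (modulo null sets), with bounded inverse. *)
definition resolvent_set ::
  "(real \<Rightarrow> complex) set \<Rightarrow> ((real \<Rightarrow> complex) \<Rightarrow> (real \<Rightarrow> complex)) \<Rightarrow> complex set" where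
  "resolvent_set D T =
     {z. (\<forall>y\<in>D. \<forall>u\<in>D. ae_eq (\<lambda>x. T y x - z * y x) (\<lambda>x. T u x - z * u x) \<longrightarrow> ae_eq y u) \<and>
         (\<forall>f\<in>L2. \<exists>y\<in>D. ae_eq (\<lambda>x. T y x - z * y x) f) \<and>
         (\<exists>C. \<forall>y\<in>D. L2norm y \<le> C * L2norm (\<lambda>x. T y x - z * y x))}"

definition spectrum ::
  "(real \<Rightarrow> complex) set \<Rightarrow> ((real \<Rightarrow> complex) \<Rightarrow> (real \<Rightarrow> complex)) \<Rightarrow> complex set" where
  "spectrum D T = - resolvent_set D T"

end

theory Submission
  imports Defs
begin

text \<open>The spectrum of \<open>L\<^sub>0\<close> contains \<open>\<lambda>\<^sub>n = (2\<pi>n)\<^sup>3\<close> with eigenfunction \<open>e\<^sub>n(x) = exp(2\<pi>inx)\<close>.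
  If the Fourier coefficient \<open>v\<^sub>n\<close> of \<open>v\<close> is nonzero, then \<open>\<lambda>\<^sub>n\<close> lies in the resolvent set of \<open>L\<^sub>\<alpha>\<close>:
  taking the \<open>n\<close>-th coefficient of \<open>(L\<^sub>\<alpha> - \<lambda>\<^sub>n)y = f\<close> gives \<open>\<alpha>\<langle>y,v\<rangle>v\<^sub>n = f\<^sub>n\<close>, which fixes \<open>\<langle>y,v\<rangle>\<close>;
  then \<open>(L\<^sub>0 - \<lambda>\<^sub>n)y = f - \<alpha>\<langle>y,v\<rangle>v\<close> has a right-hand side orthogonal to \<open>e\<^sub>n\<close>, so it determines \<open>y\<close> up to
  a multiple of \<open>e\<^sub>n\<close>, and since \<open>\<langle>e\<^sub>n,v\<rangle> \<noteq> 0\<close> that multiple is fixed by the value of \<open>\<langle>y,v\<rangle>\<close>.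
  Hence equality of the spectra forces all \<open>v\<^sub>n\<close> to vanish.\<close>

section \<open>Smooth bump functions\<close>

text \<open>Only one inclusion of the spectra is used: that of \<open>L_zero\<close> inside that of
  \<open>L_op\<close>. Membership in \<open>resolvent_set\<close> demands bijectivity and a bound at
  the eigenvalue itself, so a solution operator with sup-norm estimates is written down explicitly.
  The obstacle is the domain: weak derivatives are chosen representatives tested against smooth
  functions, whereas solving the equation needs integration by parts and boundary values. Hence the
  integrated relation \<open>antideriv\<close> and the translations \<open>dom_L_I\<close> and
  \<open>dom_L_E\<close>; the latter rests on the fundamental lemma, and so on explicit bump
  functions. Solvability at a resonance is reduced to first-order factors; at \<open>n = 0\<close>
  all of them are resonant at once. Completeness of the exponentials enters twice: in injectivity,
  where a difference with at most one nonzero coefficient must be a multiple of the eigenfunction,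
  and in the conclusion. Solving for the pairing with \<open>v\<close> divides by \<alpha>, which is
  where \<alpha> \<noteq> 0 is needed.\<close>

text \<open>No formula for the n-th derivative is required: iterating \<open>deriv\<close> never
  leaves a family that is closed under differentiation, so it suffices to exhibit such a
  family.\<close>

lemma deriv_closed_imp_smooth:
  fixes S :: "(real \<Rightarrow> real) set"
  assumes "f \<in> S"
    and closed: "\<And>h. h \<in> S \<Longrightarrow> \<exists>h'\<in>S. \<forall>x. (h has_real_derivative h' x) (at x)"
  shows "(deriv ^^ n) f field_differentiable at x"
proof -
  have "(deriv ^^ n) f \<in> S"
  proof (induction n)
    case (Suc n)
    then obtain h' where h': "h' \<in> S" "\<And>x. ((deriv ^^ n) f has_real_derivative h' x) (at x)"
      using closed by blast
    then have "deriv ((deriv ^^ n) f) = h'"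
      by (intro ext DERIV_imp_deriv)
    with h' show ?case by simp
  qed (use assms in simp)
  then show ?thesis
    using closed field_differentiable_def by blast
qed

text \<open>The classical flat function extended by zero; the divisor \<open>x ^ k\<close> is
  included so that derivatives are linear combinations of members of the same family.\<close>

definition flat_exp :: "nat \<Rightarrow> real \<Rightarrow> real" where
  "flat_exp k x = (if x > 0 then exp (- 1 / x) / x ^ k else 0)"

text \<open>The substitution \<open>t = 1 / x\<close> turns the right-hand limit into the decay of
  \<open>t ^ k / exp t\<close> at infinity.\<close>

lemma flat_exp_tendsto_0: "(flat_exp k \<longlongrightarrow> 0) (at 0)"
proof -
  have "((\<lambda>x. inverse x ^ k / exp (inverse x)) \<longlongrightarrow> (0::real)) (at_right 0)"
    by (rule filterlim_compose[OF tendsto_power_div_exp_0 filterlim_inverse_at_top_right])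
  then have "(flat_exp k \<longlongrightarrow> 0) (at_right 0)"
    by (rule Lim_transform_eventually)
      (auto simp: flat_exp_def eventually_at_filter exp_minus field_simps)
  moreover have "(flat_exp k \<longlongrightarrow> 0) (at_left 0)"
    by (rule tendsto_eventually) (auto simp: flat_exp_def eventually_at_filter)
  ultimately show ?thesis
    by (simp add: filterlim_split_at)
qed

text \<open>The delicate point is the origin, where the difference quotient is again a member of the
  family, with index \<open>k + 1\<close>, and so tends to 0.\<close>

lemma flat_exp_deriv:
  "(flat_exp k has_real_derivative flat_exp (k + 2) x + (- real k) * flat_exp (k + 1) x) (at x)"
proof (cases x "0::real" rule: linorder_cases)
  case less
  have "((\<lambda>x. 0) has_real_derivative 0) (at x)" by simp
  then have "(flat_exp k has_real_derivative 0) (at x)"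
    by (rule has_field_derivative_transform_within_open[where S = "{..<0}"])
      (use less in \<open>auto simp: flat_exp_def\<close>)
  then show ?thesis using less by (simp add: flat_exp_def)
next
  case equal
  have "((\<lambda>h. flat_exp k h / h) \<longlongrightarrow> 0) (at 0)"
    by (rule Lim_transform_eventually[OF flat_exp_tendsto_0[of "k + 1"]])
      (auto simp: flat_exp_def eventually_at_filter field_simps)
  with equal show ?thesis
    by (simp add: has_field_derivative_iff flat_exp_def)
next
  case greater
  have "((\<lambda>x. exp (- 1 / x) / x ^ k) has_real_derivative
      flat_exp (k + 2) x + (- real k) * flat_exp (k + 1) x) (at x)"
    using greater
    apply (auto intro!: derivative_eq_intros simp: flat_exp_def)
    \<comment> \<open>The derivative of \<open>x ^ k\<close> carries the truncated exponent
      \<open>k - 1\<close>, so \<open>k = 0\<close> is treated apart.\<close>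
    apply (cases k)
    apply (simp_all add: field_simps power2_eq_square)
    done
  then show ?thesis
    by (rule has_field_derivative_transform_within_open[where S = "{0<..}"])
      (use greater in \<open>auto simp: flat_exp_def\<close>)
qed

inductive_set flat_algebra :: "(real \<Rightarrow> real) set" where
  base: "(\<lambda>x. flat_exp k (c * x + d)) \<in> flat_algebra"
| scale: "f \<in> flat_algebra \<Longrightarrow> (\<lambda>x. c * f x) \<in> flat_algebra"
| add: "f \<in> flat_algebra \<Longrightarrow> g \<in> flat_algebra \<Longrightarrow> (\<lambda>x. f x + g x) \<in> flat_algebra"
| mult: "f \<in> flat_algebra \<Longrightarrow> g \<in> flat_algebra \<Longrightarrow> (\<lambda>x. f x * g x) \<in> flat_algebra"

lemma flat_algebra_deriv:
  assumes "h \<in> flat_algebra"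
  shows "\<exists>h'\<in>flat_algebra. \<forall>x. (h has_real_derivative h' x) (at x)"
  using assms
proof induction
  case (base k c d)
  let ?h = "\<lambda>x. c * (flat_exp (k + 2) (c * x + d) + (- real k) * flat_exp (k + 1) (c * x + d))"
  have "?h \<in> flat_algebra"
    by (intro flat_algebra.scale flat_algebra.add flat_algebra.base)
  moreover have "((\<lambda>x. flat_exp k (c * x + d)) has_real_derivative ?h x) (at x)" for x
  proof -
    have "((\<lambda>x. c * x + d) has_real_derivative c) (at x)"
      by (auto intro!: derivative_eq_intros)
    from DERIV_chain2[OF flat_exp_deriv this] show ?thesis by (simp add: mult.commute)
  qed
  ultimately show ?case by (intro bexI[of _ ?h]) auto
next
  case (scale f c)
  then obtain f' where "f' \<in> flat_algebra" "\<And>x. (f has_real_derivative f' x) (at x)" by blast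
  then show ?case
    by (intro bexI[of _ "\<lambda>x. c * f' x"]) (auto intro: flat_algebra.scale DERIV_cmult)
next
  case (add f g)
  then obtain f' g' where "f' \<in> flat_algebra" "\<And>x. (f has_real_derivative f' x) (at x)"
    "g' \<in> flat_algebra" "\<And>x. (g has_real_derivative g' x) (at x)" by blast
  then show ?case
    by (intro bexI[of _ "\<lambda>x. f' x + g' x"]) (auto intro: flat_algebra.add DERIV_add)
next
  case (mult f g)
  then obtain f' g' where "f' \<in> flat_algebra" "\<And>x. (f has_real_derivative f' x) (at x)"
    "g' \<in> flat_algebra" "\<And>x. (g has_real_derivative g' x) (at x)" by blast
  with mult.hyps show ?case
    by (intro bexI[of _ "\<lambda>x. f' x * g x + g' x * f x"])
      (auto intro: flat_algebra.add flat_algebra.mult DERIV_mult)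
qed

text \<open>The shift by 1 confines the support to \<open>{a + 1/m..b - 1/m}\<close>, which lies
  strictly inside the unit interval even for \<open>a = 0\<close> or \<open>b = 1\<close>. The
  factor \<open>m\<close> drives both arguments to infinity between \<open>a\<close> and
  \<open>b\<close>, so the bumps approximate the indicator.\<close>

definition bump :: "real \<Rightarrow> real \<Rightarrow> nat \<Rightarrow> real \<Rightarrow> real" where
  "bump a b m x = flat_exp 0 (real m * (x - a) - 1) * flat_exp 0 (real m * (b - x) - 1)"

lemma bump_nonneg: "0 \<le> bump a b m x"
  by (simp add: bump_def flat_exp_def)

lemma bump_le_1: "bump a b m x \<le> 1"
  unfolding bump_def by (rule mult_le_one) (auto simp: flat_exp_def)

lemma bump_test_function:
  assumes "0 \<le> a" "b \<le> 1" "m > 0"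
  shows "bump a b m \<in> test_functions"
proof -
  have "bump a b m = (\<lambda>x. flat_exp 0 (real m * x + (- real m * a - 1)) *
      flat_exp 0 ((- real m) * x + (real m * b - 1)))"
    by (auto simp: bump_def algebra_simps)
  also have "\<dots> \<in> flat_algebra"
    by (intro flat_algebra.intros)
  finally have "bump a b m \<in> flat_algebra" .
  then have "\<forall>n x. (deriv ^^ n) (bump a b m) field_differentiable at x"
    using deriv_closed_imp_smooth flat_algebra_deriv by blast
  moreover have "\<forall>x. x \<notin> {a + 1 / m..b - 1 / m} \<longrightarrow> bump a b m x = 0"
  proof (intro allI impI)
    fix x assume "x \<notin> {a + 1 / m..b - 1 / m}"
    then have "real m * (x - a) - 1 \<le> 0 \<or> real m * (b - x) - 1 \<le> 0"
      using assms by (auto simp: field_simps)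
    then show "bump a b m x = 0"
      by (auto simp: bump_def flat_exp_def)
  qed
  moreover have "0 < a + 1 / m" "b - 1 / m < 1"
    using assms by (auto intro: add_nonneg_pos simp: le_less_trans[OF \<open>b \<le> 1\<close>] diff_less_eq)
  ultimately show ?thesis
    unfolding test_functions_def by blast
qed

lemma flat_exp_tendsto_1: "(flat_exp 0 \<longlongrightarrow> 1) at_top"
proof -
  have "((\<lambda>x::real. exp (- 1 / x)) \<longlongrightarrow> exp 0) at_top"
    by (intro tendsto_exp tendsto_divide_0[OF tendsto_const] filterlim_at_top_imp_at_infinity filterlim_ident)
  then show ?thesis
    unfolding exp_zero
    by (rule Lim_transform_eventually, intro eventually_mono[OF eventually_gt_at_top[of 0]])
      (simp add: flat_exp_def)
qed

text \<open>At the endpoints every bump vanishes, whereas the indicator of a nonempty interval is 1;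
  excluding them costs only a null set.\<close>

lemma bump_tendsto:
  assumes "x \<noteq> a" "x \<noteq> b"
  shows "(\<lambda>m. bump a b m x) \<longlonglongrightarrow> indicator {a..b} x"
proof -
  have pos: "(\<lambda>m. flat_exp 0 (real m * c - 1)) \<longlonglongrightarrow> 1" if "c > 0" for c
    by (rule filterlim_compose[OF flat_exp_tendsto_1])
      (use that in \<open>intro filterlim_tendsto_add_at_top[OF tendsto_const, of _ _ "-1", simplified]
        filterlim_at_top_mult_tendsto_pos[OF tendsto_const] filterlim_real_sequentially;
        simp add: mult.commute\<close>)
  have "bump a b m x = 0" if "x < a \<or> b < x" for m
  proof -
    have "real m * (x - a) \<le> 0 \<or> real m * (b - x) \<le> 0"
      using that by (auto simp: mult_le_0_iff)
    then show ?thesis by (auto simp: bump_def flat_exp_def)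
  qed
  moreover have "(\<lambda>m. bump a b m x) \<longlonglongrightarrow> 1 * 1" if "a < x" "x < b"
    unfolding bump_def by (intro tendsto_mult pos) (use that in auto)
  ultimately show ?thesis
    using assms by (cases "x < a \<or> b < x") (auto simp: indicator_def)
qed

section \<open>The fundamental lemma of the calculus of variations\<close>

interpretation unit_meas: finite_measure unit_meas
  by (rule finite_measure_lebesgue_on) (metis lmeasurable_interval(2))

lemma measure_unit_meas [simp]: "measure unit_meas {0<..<1} = 1"
  by (simp add: measure_restrict_space)

lemma borel_imp_measurable_unit_meas:
  "f \<in> measurable borel M \<Longrightarrow> f \<in> measurable unit_meas M"
  by (intro measurable_restrict_space1 measurable_completion) simp

lemma id_measurable_unit_meas [measurable]: "(\<lambda>x. x) \<in> borel_measurable unit_meas"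
  by (rule borel_imp_measurable_unit_meas) simp

lemma continuous_measurable_unit_meas:
  fixes f :: "real \<Rightarrow> 'a::euclidean_space"
  assumes "continuous_on {0..1} f"
  shows "f \<in> borel_measurable unit_meas"
proof -
  have "f \<in> borel_measurable (lebesgue_on {0..1})"
    by (rule continuous_imp_measurable_on_sets_lebesgue[OF assms]) auto
  then show ?thesis
    by (rule measurable_restrict_mono) auto
qed

lemma AE_unit_meas_neq: "AE x in unit_meas. x \<noteq> c"
proof -
  have "AE x in lebesgue. x \<noteq> c"
    by (rule AE_completion) (rule AE_lborel_singleton)
  then show ?thesis
    by (subst AE_restrict_space_iff) auto
qed

lemma AE_unit_measI: "(\<And>x. 0 < x \<Longrightarrow> x < 1 \<Longrightarrow> P x) \<Longrightarrow> AE x in unit_meas. P x"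
  by (rule AE_I2) auto

lemma integrable_mult_bounded:
  fixes f g :: "real \<Rightarrow> complex"
  assumes f: "integrable unit_meas f" and g: "g \<in> borel_measurable unit_meas"
    and bd: "\<And>x. 0 < x \<Longrightarrow> x < 1 \<Longrightarrow> norm (g x) \<le> B"
  shows "integrable unit_meas (\<lambda>x. f x * g x)"
proof (rule Bochner_Integration.integrable_bound)
  show "integrable unit_meas (\<lambda>x. B * norm (f x))"
    using f by auto
  show "(\<lambda>x. f x * g x) \<in> borel_measurable unit_meas"
    using f g by measurable
  show "AE x in unit_meas. norm (f x * g x) \<le> norm (B * norm (f x))"
  proof (rule AE_unit_measI)
    fix x :: real assume "0 < x" "x < 1"
    then have "norm (g x) \<le> \<bar>B\<bar>"
      using bd[of x] by linarith
    then show "norm (f x * g x) \<le> norm (B * norm (f x))"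
      using mult_right_mono[OF _ norm_ge_zero[of "f x"], of "norm (g x)" "\<bar>B\<bar>"]
      by (simp add: norm_mult abs_mult mult.commute)
  qed
qed

lemma integrable_mult_continuous:
  fixes f g :: "real \<Rightarrow> complex"
  assumes f: "integrable unit_meas f" and g: "continuous_on {0..1} g"
  shows "integrable unit_meas (\<lambda>x. f x * g x)"
proof -
  have "bounded (g ` {0..1})"
    using g by (intro compact_imp_bounded compact_continuous_image) auto
  then obtain B where "\<forall>y\<in>g ` {0..1}. norm y \<le> B"
    unfolding bounded_iff by blast
  then show ?thesis
    by (intro integrable_mult_bounded[OF f continuous_measurable_unit_meas[OF g], of B]) auto
qed

lemma integrable_continuous_unit_meas:
  fixes g :: "real \<Rightarrow> complex"
  assumes "continuous_on {0..1} g"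
  shows "integrable unit_meas g"
  using integrable_mult_continuous[of "\<lambda>x. 1", OF _ assms] by simp

lemma test_function_continuous:
  "\<phi> \<in> test_functions \<Longrightarrow> continuous_on A (\<lambda>x. complex_of_real (\<phi> x))"
  unfolding test_functions_def
  by (auto intro!: continuous_intros continuous_at_imp_continuous_on
      field_differentiable_imp_continuous_at dest: spec[of _ "0::nat"])

text \<open>Dynkin argument: the sets over which the integral vanishes contain the closed intervals
  and are stable under complements and disjoint countable unions.\<close>

lemma integral_eq_0_borel:
  fixes u :: "real \<Rightarrow> complex"
  assumes u: "integrable unit_meas u"
    and intervals: "\<And>a b. 0 \<le> a \<Longrightarrow> b \<le> 1 \<Longrightarrow> (LINT x|unit_meas. indicator {a..b} x *\<^sub>R u x) = 0"
    and "A \<in> sets borel"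
  shows "(LINT x|unit_meas. indicator A x *\<^sub>R u x) = 0"
  using \<open>A \<in> sets borel\<close>
proof (induction rule: borel_set_induct)
  case (interval a b)
  \<comment> \<open>The measure lives on the open unit interval, so an arbitrary interval may be
    clipped to fit the hypothesis.\<close>
  have "(LINT x|unit_meas. indicator {a..b} x *\<^sub>R u x) =
      (LINT x|unit_meas. indicator {max a 0..min b 1} x *\<^sub>R u x)"
    by (rule Bochner_Integration.integral_cong) (auto simp: indicator_def)
  then show ?case using intervals[of "max a 0" "min b 1"] by simp
next
  case (compl A)
  have meas: "A \<inter> {0<..<1} \<in> sets unit_meas"
    using compl by (auto simp: sets_restrict_space)
  have "integrable unit_meas (\<lambda>x. indicator (A \<inter> {0<..<1}) x *\<^sub>R u x)"
    by (rule integrable_mult_indicator[OF meas u])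
  then have iA: "integrable unit_meas (\<lambda>x. indicator A x *\<^sub>R u x)"
    by (rule Bochner_Integration.integrable_cong[THEN iffD1, rotated 2]) (auto simp: indicator_def)
  \<comment> \<open>Complements require the total integral to vanish, which is the hypothesis for
    \<open>{0..1}\<close>.\<close>
  have "(LINT x|unit_meas. u x) = (LINT x|unit_meas. indicator {0..1} x *\<^sub>R u x)"
    by (rule Bochner_Integration.integral_cong) (auto simp: indicator_def)
  then have 0: "(LINT x|unit_meas. u x) = 0"
    using intervals by simp
  have "(LINT x|unit_meas. indicator (- A) x *\<^sub>R u x) = (LINT x|unit_meas. u x - indicator A x *\<^sub>R u x)"
    by (rule Bochner_Integration.integral_cong) (auto simp: indicator_def)
  also have "\<dots> = 0"
    using 0 compl by (simp add: Bochner_Integration.integral_diff[OF u iA])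
  finally show ?case .
next
  case (union f)
  let ?f = "\<lambda>i. f i \<inter> {0<..<1}"
  have meas: "?f i \<in> sets unit_meas" for i
    using union by (auto simp: sets_restrict_space)
  have cong: "(LINT x|unit_meas. indicator A x *\<^sub>R u x) =
      (LINT x:(A \<inter> {0<..<1})|unit_meas. u x)" for A
    unfolding set_lebesgue_integral_def
    by (rule Bochner_Integration.integral_cong) (auto simp: indicator_def)
  have "(LINT x:(\<Union>i. ?f i)|unit_meas. u x) = (\<Sum>i. LINT x:?f i|unit_meas. u x)"
  proof (rule lebesgue_integral_countable_add[OF meas])
    show "set_integrable unit_meas (\<Union>i. ?f i) u"
      unfolding set_integrable_def using meas by (intro integrable_mult_indicator u) blast
  qed (use union in \<open>auto simp: disjoint_family_on_def\<close>)
  also have "\<dots> = 0"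
    using union by (simp flip: cong)
  finally show ?case
    unfolding cong[of "\<Union>i. f i"] by (simp add: Int_UN_distrib2)
qed simp

text \<open>A function whose integral over every measurable set is zero vanishes almost everywhere;
  a Lebesgue set is a Borel set up to a null set, so the Borel case suffices.\<close>

lemma AE_0_if_integral_intervals_0:
  fixes u :: "real \<Rightarrow> complex"
  assumes u: "integrable unit_meas u"
    and intervals: "\<And>a b. 0 \<le> a \<Longrightarrow> b \<le> 1 \<Longrightarrow> (LINT x|unit_meas. indicator {a..b} x *\<^sub>R u x) = 0"
  shows "AE x in unit_meas. u x = 0"
proof (rule unit_meas.density_zero[OF u])
  fix A assume "A \<in> sets unit_meas"
  then have A: "A \<in> sets (completion lborel)" "A \<subseteq> {0<..<1}"
    by (auto simp: sets_restrict_space)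
  then obtain S N N' where S: "A = S \<union> N" "N \<subseteq> N'" "N' \<in> null_sets lborel" "S \<in> sets lborel"
    by (elim sets_completionE)
  have "AE x in lebesgue. x \<notin> N'"
    by (rule AE_completion, rule AE_not_in) (rule S)
  then have ae: "AE x in unit_meas. x \<notin> N'"
    by (subst AE_restrict_space_iff) auto
  have SM: "S \<in> sets unit_meas"
    using S A by (auto simp: sets_restrict_space)
  have "(LINT x:A|unit_meas. u x) = (LINT x|unit_meas. indicator S x *\<^sub>R u x)"
    unfolding set_lebesgue_integral_def
  proof (rule integral_cong_AE)
    show "AE x in unit_meas. indicat_real A x *\<^sub>R u x = indicat_real S x *\<^sub>R u x"
      using ae by eventually_elim (use S in \<open>auto simp: indicator_def\<close>)
    show "(\<lambda>x. indicat_real A x *\<^sub>R u x) \<in> borel_measurable unit_meas"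
      using integrable_mult_indicator[OF \<open>A \<in> sets unit_meas\<close> u] by (rule borel_measurable_integrable)
    show "(\<lambda>x. indicat_real S x *\<^sub>R u x) \<in> borel_measurable unit_meas"
      using integrable_mult_indicator[OF SM u] by (rule borel_measurable_integrable)
  qed
  also have "\<dots> = 0"
    using S by (intro integral_eq_0_borel[OF u intervals]) auto
  finally show "(LINT x:A|unit_meas. u x) = 0" .
qed

text \<open>Dominated convergence along bumps, which are bounded by 1, carries the hypothesis over
  to indicators of intervals. Using \<open>Suc m\<close> keeps the bump parameter positive.\<close>

lemma fundamental_lemma:
  fixes u :: "real \<Rightarrow> complex"
  assumes u: "integrable unit_meas u"
    and test: "\<And>\<psi>. \<psi> \<in> test_functions \<Longrightarrow> (LINT x|unit_meas. u x * complex_of_real (\<psi> x)) = 0"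
  shows "AE x in unit_meas. u x = 0"
proof (rule AE_0_if_integral_intervals_0[OF u])
  fix a b :: real assume ab: "0 \<le> a" "b \<le> 1"
  note b = bump_test_function[OF ab]
  have "(\<lambda>m. LINT x|unit_meas. u x * complex_of_real (bump a b (Suc m) x)) \<longlonglongrightarrow>
      (LINT x|unit_meas. indicator {a..b} x *\<^sub>R u x)"
  proof (rule integral_dominated_convergence)
    show "integrable unit_meas (\<lambda>x. norm (u x))"
      using u by auto
    show "(\<lambda>x. u x * complex_of_real (bump a b (Suc m) x)) \<in> borel_measurable unit_meas" for m
      using u by (intro borel_measurable_integrable integrable_mult_continuous test_function_continuous b) auto
    show "AE x in unit_meas. norm (u x * complex_of_real (bump a b (Suc m) x)) \<le> norm (u x)" for m
      by (rule AE_I2) (use bump_nonneg[of a b "Suc m"] bump_le_1[of a b "Suc m"] in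
        \<open>auto simp: norm_mult intro!: mult_right_le_one_le\<close>)
    show "AE x in unit_meas. (\<lambda>m. u x * complex_of_real (bump a b (Suc m) x)) \<longlonglongrightarrow> indicator {a..b} x *\<^sub>R u x"
      using AE_unit_meas_neq[of a] AE_unit_meas_neq[of b]
    proof eventually_elim
      case (elim x)
      have "(\<lambda>m. u x * complex_of_real (bump a b (Suc m) x)) \<longlonglongrightarrow> u x * complex_of_real (indicator {a..b} x)"
        by (intro tendsto_intros LIMSEQ_Suc[OF bump_tendsto] elim)
      then show ?case by (simp add: scaleR_conv_of_real mult.commute)
    qed
    show "(\<lambda>x. indicat_real {a..b} x *\<^sub>R u x) \<in> borel_measurable unit_meas"
      using u by measurable
  qed
  then show "(LINT x|unit_meas. indicator {a..b} x *\<^sub>R u x) = 0"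
    by (simp only: test[OF b[OF zero_less_Suc]] LIMSEQ_const_iff)
qed

section \<open>Integration by parts\<close>

text \<open>The half-line \<open>{..x}\<close> can replace \<open>{0..x}\<close> because
  \<open>unit_meas\<close> ignores everything outside the unit interval; \<open>prim u\<close> is
  then defined and continuous on the whole line.\<close>

definition prim :: "(real \<Rightarrow> complex) \<Rightarrow> real \<Rightarrow> complex" where
  "prim u x = (LINT t|unit_meas. indicator {..x} t *\<^sub>R u t)"

lemma integrable_indicator_unit_meas:
  fixes u :: "real \<Rightarrow> complex"
  assumes "integrable unit_meas u" "A \<in> sets borel"
  shows "integrable unit_meas (\<lambda>t. indicator A t *\<^sub>R u t)"
proof (rule Bochner_Integration.integrable_bound[OF assms(1)])
  show "(\<lambda>t. indicat_real A t *\<^sub>R u t) \<in> borel_measurable unit_meas"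
    using assms borel_imp_measurable_unit_meas[OF borel_measurable_indicator[OF assms(2)]] by measurable
qed (simp add: indicator_def)

lemma prim_0 [simp]: "prim u 0 = 0"
proof -
  have "prim u 0 = (LINT t|unit_meas. 0)"
    unfolding prim_def by (rule Bochner_Integration.integral_cong) (auto simp: indicator_def)
  then show ?thesis by simp
qed

lemma prim_1: "1 \<le> x \<Longrightarrow> prim u x = (LINT t|unit_meas. u t)"
  unfolding prim_def by (rule Bochner_Integration.integral_cong) (auto simp: indicator_def)

lemma norm_prim_le:
  assumes "integrable unit_meas u"
  shows "norm (prim u x) \<le> (LINT t|unit_meas. norm (u t))"
proof -
  have "norm (prim u x) \<le> (LINT t|unit_meas. norm (indicator {..x} t *\<^sub>R u t))"
    unfolding prim_def by (rule integral_norm_bound)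
  also have "\<dots> \<le> (LINT t|unit_meas. norm (u t))"
    by (intro integral_mono Bochner_Integration.integrable_norm integrable_indicator_unit_meas assms)
      (auto simp: indicator_def)
  finally show ?thesis .
qed

lemma prim_add:
  assumes "integrable unit_meas u" "integrable unit_meas v"
  shows "prim (\<lambda>t. u t + v t) x = prim u x + prim v x"
  unfolding prim_def
  by (subst Bochner_Integration.integral_add[symmetric])
    (auto intro: integrable_indicator_unit_meas assms simp: algebra_simps)

lemma prim_cmult: "prim (\<lambda>t. c * u t) x = c * prim u x"
  unfolding prim_def by (subst integral_mult_right_zero[symmetric]) simp

text \<open>For mere integrability of \<open>u\<close> this is dominated convergence: the indicators
  of \<open>{..X n}\<close> converge at every point except possibly the limit of
  \<open>X\<close>.\<close>

lemma continuous_prim: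
  assumes u: "integrable unit_meas u"
  shows "continuous_on A (prim u)"
proof (rule continuous_at_imp_continuous_on, rule ballI)
  fix x
  show "isCont (prim u) x"
    unfolding continuous_at_sequentially o_def
  proof (intro allI impI)
    fix X :: "nat \<Rightarrow> real" assume X: "X \<longlonglongrightarrow> x"
    show "(\<lambda>n. prim u (X n)) \<longlonglongrightarrow> prim u x"
      unfolding prim_def
    proof (rule integral_dominated_convergence)
      show "integrable unit_meas (\<lambda>t. norm (u t))"
        using u by auto
      show "AE t in unit_meas. (\<lambda>n. indicator {..X n} t *\<^sub>R u t) \<longlonglongrightarrow> indicator {..x} t *\<^sub>R u t"
        using AE_unit_meas_neq[of x]
      proof eventually_elim
        case (elim t)
        have "\<forall>\<^sub>F n in sequentially. indicat_real {..X n} t = indicator {..x} t"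
        proof (cases "t < x")
          case True
          from order_tendstoD(1)[OF X this] show ?thesis
            by eventually_elim (use True in auto)
        next
          case False
          with elim have "x < t" by simp
          from order_tendstoD(2)[OF X this] show ?thesis
            by eventually_elim (use False elim in auto)
        qed
        then show ?case
          by (intro tendsto_eventually) (auto elim: eventually_mono)
      qed
      show "(\<lambda>t. indicat_real {..X n} t *\<^sub>R u t) \<in> borel_measurable unit_meas"
        "(\<lambda>t. indicat_real {..x} t *\<^sub>R u t) \<in> borel_measurable unit_meas" for n
        by (intro borel_measurable_integrable integrable_indicator_unit_meas u; simp)+
    qed (simp add: indicator_def)
  qed
qed

interpretation unit_meas_pair: pair_sigma_finite unit_meas unit_meas ..

text \<open>Fubini on the triangle \<open>t \<le> s \<le> x\<close>. This is the core of integration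
  by parts when one factor is only absolutely continuous.\<close>

lemma prim_swap:
  assumes u: "integrable unit_meas u" and h: "continuous_on {0..1} h"
  shows "prim (\<lambda>s. prim u s * h s) x =
    (LINT t|unit_meas. u t * (LINT s|unit_meas. indicator {t..x} s *\<^sub>R h s))"
proof -
  have [measurable]: "u \<in> borel_measurable unit_meas" "h \<in> borel_measurable unit_meas"
    using u continuous_measurable_unit_meas[OF h] by auto
  let ?F = "\<lambda>s t. (if t \<le> s \<and> s \<le> x then u t * h s else 0)"
  \<comment> \<open>The full product is integrable on the square and dominates its restriction to
    the triangle.\<close>
  have hu: "integrable (unit_meas \<Otimes>\<^sub>M unit_meas) (\<lambda>(s, t). u t * h s)"
  proof (rule unit_meas_pair.Fubini_integrable)
    show "integrable unit_meas (\<lambda>s. LINT t|unit_meas. norm (case (s, t) of (s, t) \<Rightarrow> u t * h s))"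
      using integrable_continuous_unit_meas[OF h] by (auto simp: norm_mult)
    show "AE s in unit_meas. integrable unit_meas (\<lambda>t. case (s, t) of (s, t) \<Rightarrow> u t * h s)"
      using u by auto
  qed measurable
  have F: "integrable (unit_meas \<Otimes>\<^sub>M unit_meas) (\<lambda>(s, t). ?F s t)"
    by (rule Bochner_Integration.integrable_bound[OF hu]) (measurable, auto)
  have "prim (\<lambda>s. prim u s * h s) x = (LINT s|unit_meas. LINT t|unit_meas. ?F s t)"
    unfolding prim_def
  proof (rule Bochner_Integration.integral_cong[OF refl])
    fix s
    have "indicator {..x} s *\<^sub>R ((LINT t|unit_meas. indicator {..s} t *\<^sub>R u t) * h s) =
       (LINT t|unit_meas. indicator {..x} s *\<^sub>R ((indicator {..s} t *\<^sub>R u t) * h s))"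
      by (simp only: integral_scaleR_right integral_mult_left_zero)
    also have "\<dots> = (LINT t|unit_meas. ?F s t)"
      by (rule Bochner_Integration.integral_cong) (auto simp: indicator_def)
    finally show "indicator {..x} s *\<^sub>R ((LINT t|unit_meas. indicator {..s} t *\<^sub>R u t) * h s) = \<dots>" .
  qed
  also have "\<dots> = (LINT t|unit_meas. LINT s|unit_meas. ?F s t)"
    using unit_meas_pair.Fubini_integral[OF F] by simp
  also have "\<dots> = (LINT t|unit_meas. u t * (LINT s|unit_meas. indicator {t..x} s *\<^sub>R h s))"
  proof (rule Bochner_Integration.integral_cong[OF refl])
    fix t
    show "(LINT s|unit_meas. ?F s t) = u t * (LINT s|unit_meas. indicator {t..x} s *\<^sub>R h s)"
      by (subst integral_mult_right_zero[symmetric], rule Bochner_Integration.integral_cong)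
        (auto simp: indicator_def)
  qed
  finally show ?thesis .
qed

lemma FTC_unit_meas:
  fixes E E' :: "real \<Rightarrow> complex"
  assumes deriv: "\<And>x. (E has_vector_derivative E' x) (at x)" and E': "continuous_on {0..1} E'"
    and "0 \<le> t" "t \<le> x" "x \<le> 1"
  shows "(LINT s|unit_meas. indicator {t..x} s *\<^sub>R E' s) = E x - E t"
proof -
  have "(E' has_integral (E x - E t)) {t..x}"
    using assms by (intro fundamental_theorem_of_calculus) (auto intro: has_vector_derivative_at_within)
  then have "((\<lambda>s. if s \<in> {t..x} then E' s else 0) has_integral (E x - E t)) {0..1}"
    using assms by (subst has_integral_restrict) auto
  also have "(\<lambda>s. if s \<in> {t..x} then E' s else 0) = (\<lambda>s. indicator {t..x} s *\<^sub>R E' s)"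
    by (auto simp: indicator_def)
  finally have "((\<lambda>s. indicator {t..x} s *\<^sub>R E' s) has_integral (E x - E t)) {0<..<1}"
    by (simp only: has_integral_Icc_iff_Ioo)
  moreover have "integrable unit_meas (\<lambda>s. indicator {t..x} s *\<^sub>R E' s)"
    by (intro integrable_indicator_unit_meas integrable_continuous_unit_meas E') auto
  ultimately show ?thesis
    by (subst lebesgue_integral_eq_integral) auto
qed

text \<open>Absolute continuity of \<open>w\<close> on the unit interval with derivative \<open>u\<close>, in integrated form.\<close>
definition antideriv :: "(real \<Rightarrow> complex) \<Rightarrow> (real \<Rightarrow> complex) \<Rightarrow> bool" where
  "antideriv w u \<longleftrightarrow> integrable unit_meas u \<and> (\<forall>x\<in>{0..1}. w x = w 0 + prim u x)"

lemma antideriv_integrable: "antideriv w u \<Longrightarrow> integrable unit_meas u"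
  by (simp add: antideriv_def)

lemma antideriv_eq: "antideriv w u \<Longrightarrow> x \<in> {0..1} \<Longrightarrow> w x = w 0 + prim u x"
  unfolding antideriv_def by blast

lemma antiderivI:
  "integrable unit_meas u \<Longrightarrow> (\<And>x. x \<in> {0..1} \<Longrightarrow> w x = w 0 + prim u x) \<Longrightarrow> antideriv w u"
  unfolding antideriv_def by blast

lemma antideriv_continuous:
  assumes "antideriv w u"
  shows "continuous_on {0..1} w"
proof -
  have "continuous_on {0..1} (\<lambda>x. w 0 + prim u x)"
    by (intro continuous_intros continuous_prim antideriv_integrable[OF assms])
  then show ?thesis
    by (rule continuous_on_eq) (rule antideriv_eq[OF assms, symmetric])
qed

lemma antideriv_integral: "antideriv w u \<Longrightarrow> (LINT t|unit_meas. u t) = w 1 - w 0"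
  using prim_1[of 1 u] unfolding antideriv_def by (metis add_diff_cancel_left' atLeastAtMost_iff order_refl zero_le_one)

lemma antideriv_prim: "integrable unit_meas u \<Longrightarrow> antideriv (\<lambda>x. c + prim u x) u"
  by (simp add: antideriv_def)

lemma antideriv_add:
  assumes "antideriv w u" "antideriv w' u'"
  shows "antideriv (\<lambda>x. w x + w' x) (\<lambda>x. u x + u' x)"
proof (rule antiderivI)
  fix x :: real assume x: "x \<in> {0..1}"
  have "w x + w' x = (w 0 + prim u x) + (w' 0 + prim u' x)"
    by (simp only: antideriv_eq[OF assms(1) x, symmetric] antideriv_eq[OF assms(2) x, symmetric])
  then show "w x + w' x = w 0 + w' 0 + prim (\<lambda>x. u x + u' x) x"
    by (simp only: prim_add[OF assms[THEN antideriv_integrable]] ac_simps)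
qed (intro Bochner_Integration.integrable_add assms[THEN antideriv_integrable])

lemma antideriv_cmult: "antideriv w u \<Longrightarrow> antideriv (\<lambda>x. c * w x) (\<lambda>x. c * u x)"
  unfolding antideriv_def prim_cmult by (metis distrib_left integrable_mult_right)

lemma prim_cong_AE:
  assumes "integrable unit_meas u" "integrable unit_meas v" "AE x in unit_meas. u x = v x"
  shows "prim u x = prim v x"
  unfolding prim_def
  using assms by (intro integral_cong_AE borel_measurable_integrable integrable_indicator_unit_meas) auto

lemma antideriv_cong_AE:
  assumes "antideriv w u" "integrable unit_meas v" "AE x in unit_meas. u x = v x"
  shows "antideriv w v"
  by (rule antiderivI[OF assms(2)])
    (use antideriv_eq[OF assms(1)] prim_cong_AE[OF antideriv_integrable[OF assms(1)] assms(2,3)] in metis)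

lemma antideriv_C1:
  fixes E E' :: "real \<Rightarrow> complex"
  assumes deriv: "\<And>x. (E has_vector_derivative E' x) (at x)" and E': "continuous_on {0..1} E'"
  shows "antideriv E E'"
  unfolding antideriv_def
proof (intro conjI ballI)
  fix x :: real assume x: "x \<in> {0..1}"
  have "prim E' x = (LINT s|unit_meas. indicator {0..x} s *\<^sub>R E' s)"
    unfolding prim_def by (rule Bochner_Integration.integral_cong) (auto simp: indicator_def)
  also have "\<dots> = E x - E 0"
    by (rule FTC_unit_meas[OF assms]) (use x in auto)
  finally show "E x = E 0 + prim E' x" by simp
qed (rule integrable_continuous_unit_meas[OF E'])

text \<open>Product rule with \<open>w\<close> absolutely continuous and \<open>E\<close> of class
  C^1. Writing \<open>w\<close> as \<open>w 0 + prim u\<close> leaves the term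
  \<open>prim u * E'\<close>; exchanging the order of integration and integrating \<open>E'\<close>
  from \<open>t\<close> to \<open>x\<close> turns it into integrals of \<open>u\<close>
  alone.\<close>

lemma antideriv_mult:
  fixes E E' :: "real \<Rightarrow> complex"
  assumes w: "antideriv w u"
    and deriv: "\<And>x. (E has_vector_derivative E' x) (at x)" and E': "continuous_on {0..1} E'"
  shows "antideriv (\<lambda>x. w x * E x) (\<lambda>x. u x * E x + w x * E' x)"
proof -
  have u: "integrable unit_meas u" using w by (rule antideriv_integrable)
  have E: "continuous_on {0..1} E"
    by (intro continuous_at_imp_continuous_on ballI has_vector_derivative_continuous[OF deriv])
  have pu: "continuous_on {0..1} (prim u)" by (rule continuous_prim[OF u])
  have uE: "integrable unit_meas (\<lambda>x. u x * E x)"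
    by (rule integrable_mult_continuous[OF u E])
  have int: "integrable unit_meas (\<lambda>x. w x * E' x)"
    by (intro integrable_continuous_unit_meas continuous_intros antideriv_continuous[OF w] E')
  have "w x * E x = w 0 * E 0 + prim (\<lambda>x. u x * E x + w x * E' x) x" if x: "x \<in> {0..1}" for x
  proof -
    have "prim (\<lambda>s. w s * E' s) x = prim (\<lambda>s. w 0 * E' s + prim u s * E' s) x"
    proof -
      have "w s * E' s = w 0 * E' s + prim u s * E' s" if "0 < s" "s < 1" for s
      proof -
        have "w s = w 0 + prim u s"
          using that by (intro antideriv_eq[OF w]) auto
        then show ?thesis by (simp add: distrib_right)
      qed
      then show ?thesis
        by (intro prim_cong_AE int AE_unit_measI integrable_continuous_unit_meas continuous_intros E' pu)
    qed
    also have "\<dots> = w 0 * prim E' x + prim (\<lambda>s. prim u s * E' s) x"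
      by (subst prim_add)
        (auto intro!: integrable_continuous_unit_meas continuous_intros E' pu simp: prim_cmult)
    also have "prim E' x = E x - E 0"
      using antideriv_eq[OF antideriv_C1[OF deriv E'] x] by simp
    also have "prim (\<lambda>s. prim u s * E' s) x =
        (LINT t|unit_meas. indicator {..x} t *\<^sub>R (u t * E x) - indicator {..x} t *\<^sub>R (u t * E t))"
      unfolding prim_swap[OF u E']
    proof (rule Bochner_Integration.integral_cong[OF refl])
      fix t assume "t \<in> space unit_meas"
      then have t: "0 < t" "t < 1" by auto
      show "u t * (LINT s|unit_meas. indicator {t..x} s *\<^sub>R E' s) =
          indicator {..x} t *\<^sub>R (u t * E x) - indicator {..x} t *\<^sub>R (u t * E t)"
      proof (cases "t \<le> x")
        case True
        then show ?thesis
          using t x by (subst FTC_unit_meas[OF deriv E']) (auto simp: algebra_simps)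
      qed auto
    qed
    also have "\<dots> = prim u x * E x - prim (\<lambda>s. u s * E s) x"
      unfolding prim_def
      using Bochner_Integration.integral_diff[OF integrable_indicator_unit_meas[OF integrable_mult_left[OF u]]
          integrable_indicator_unit_meas[OF uE], of "{..x}" "{..x}" "E x"]
      by (simp flip: mult_scaleR_left)
    finally have "prim (\<lambda>s. w s * E' s) x =
        w 0 * (E x - E 0) + (prim u x * E x - prim (\<lambda>s. u s * E s) x)" .
    moreover have "w x = w 0 + prim u x"
      using w x by (rule antideriv_eq)
    ultimately show ?thesis
      unfolding prim_add[OF uE int] by (simp add: algebra_simps)
  qed
  then show ?thesis
    using uE int by (intro antiderivI Bochner_Integration.integrable_add)
qed

section \<open>Weak derivatives and the domain of the operator\<close>

definition smooth :: "(real \<Rightarrow> real) \<Rightarrow> bool" where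
  "smooth f \<longleftrightarrow> (\<forall>n x. (deriv ^^ n) f field_differentiable at x)"

lemma smooth_has_deriv:
  assumes "smooth f" shows "(f has_real_derivative deriv f x) (at x)"
proof -
  have "(deriv ^^ 0) f field_differentiable at x"
    using assms unfolding smooth_def by blast
  then show ?thesis
    by (simp add: DERIV_deriv_iff_field_differentiable)
qed

lemma smooth_deriv: "smooth f \<Longrightarrow> smooth (deriv f)"
  unfolding smooth_def by (metis comp_apply funpow_Suc_right)

lemma smooth_lincomb:
  assumes "smooth f" "smooth g"
  shows "smooth (\<lambda>x. f x + c * g x)"
  unfolding smooth_def
proof (intro allI)
  fix n x
  show "(deriv ^^ n) (\<lambda>x. f x + c * g x) field_differentiable at x"
  proof (rule deriv_closed_imp_smooth[where S = "{\<lambda>x. p x + c * q x | p q. smooth p \<and> smooth q}"])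
    fix h assume "h \<in> {\<lambda>x. p x + c * q x | p q. smooth p \<and> smooth q}"
    then obtain p q where h: "h = (\<lambda>x. p x + c * q x)" "smooth p" "smooth q" by blast
    have "(h has_real_derivative deriv p x + c * deriv q x) (at x)" for x
      unfolding h(1) by (intro DERIV_add DERIV_cmult smooth_has_deriv h)
    then show "\<exists>h'\<in>{\<lambda>x. p x + c * q x | p q. smooth p \<and> smooth q}. \<forall>x. (h has_real_derivative h' x) (at x)"
      using h smooth_deriv by (intro bexI[of _ "\<lambda>x. deriv p x + c * deriv q x"]) blast+
  qed (use assms in blast)
qed

text \<open>Adding one primitive to the set of smooth functions leaves it closed under
  differentiation.\<close>

lemma smooth_primitive:
  assumes "\<And>x. (f has_real_derivative g x) (at x)" "smooth g"
  shows "smooth f"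
  unfolding smooth_def
proof (intro allI)
  fix n x
  show "(deriv ^^ n) f field_differentiable at x"
    by (rule deriv_closed_imp_smooth[where S = "insert f {g. smooth g}"])
      (use assms smooth_has_deriv smooth_deriv in blast)+
qed

lemma test_functions_iff:
  "\<phi> \<in> test_functions \<longleftrightarrow> smooth \<phi> \<and> (\<exists>a b. 0 < a \<and> b < 1 \<and> (\<forall>x. x \<notin> {a..b} \<longrightarrow> \<phi> x = 0))"
  unfolding test_functions_def smooth_def by blast

lemma test_function_deriv:
  assumes "\<phi> \<in> test_functions"
  shows "deriv \<phi> \<in> test_functions"
proof -
  from assms obtain a b where ab: "0 < a" "b < 1" "\<And>x. x \<notin> {a..b} \<Longrightarrow> \<phi> x = 0" and "smooth \<phi>"
    unfolding test_functions_iff by blast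
  have "deriv \<phi> x = 0" if "x \<notin> {a..b}" for x
  proof (rule DERIV_imp_deriv)
    have "((\<lambda>x. 0) has_real_derivative 0) (at x)" by simp
    then show "(\<phi> has_real_derivative 0) (at x)"
      by (rule has_field_derivative_transform_within_open[where S = "- {a..b}"])
        (use that ab(3) in auto)
  qed
  then show ?thesis
    unfolding test_functions_iff using smooth_deriv[OF \<open>smooth \<phi>\<close>] ab(1,2) by blast
qed

lemma test_function_lincomb:
  assumes "f \<in> test_functions" "g \<in> test_functions"
  shows "(\<lambda>x. f x + c * g x) \<in> test_functions"
proof -
  from assms obtain a b where f: "0 < a" "b < 1" "\<And>x. x \<notin> {a..b} \<Longrightarrow> f x = 0" and "smooth f"
    unfolding test_functions_iff by blast
  from assms obtain a' b' where g: "0 < a'" "b' < 1" "\<And>x. x \<notin> {a'..b'} \<Longrightarrow> g x = 0" and "smooth g"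
    unfolding test_functions_iff by blast
  have "\<forall>x. x \<notin> {min a a'..max b b'} \<longrightarrow> f x + c * g x = 0"
    using f(3) g(3) by (auto simp: min_def max_def split: if_splits)
  moreover have "0 < min a a'" "max b b' < 1"
    using f g by auto
  ultimately show ?thesis
    unfolding test_functions_iff using smooth_lincomb[OF \<open>smooth f\<close> \<open>smooth g\<close>] by blast
qed

lemma test_function_vector_derivative:
  assumes "\<phi> \<in> test_functions"
  shows "((\<lambda>x. complex_of_real (\<phi> x)) has_vector_derivative complex_of_real (deriv \<phi> x)) (at x)"
  using smooth_has_deriv assms
  by (intro has_vector_derivative_of_real) (simp add: test_functions_iff has_real_derivative_iff_has_vector_derivative)

lemma test_function_endpoints:
  assumes "\<phi> \<in> test_functions"
  shows "\<phi> 0 = 0" "\<phi> 1 = 0"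
  using assms unfolding test_functions_iff by auto

text \<open>A primitive is constant on either side of the support of \<eta>. Mean zero makes the two
  constants equal, so subtracting the common value restores compact support.\<close>

lemma test_function_primitive:
  assumes \<eta>: "\<eta> \<in> test_functions" and 0: "(LINT x|unit_meas. complex_of_real (\<eta> x)) = 0"
  obtains \<phi> where "\<phi> \<in> test_functions" "deriv \<phi> = \<eta>"
proof -
  from \<eta> obtain a b where ab: "0 < a" "b < 1" "\<And>x. x \<notin> {a..b} \<Longrightarrow> \<eta> x = 0" and "smooth \<eta>"
    unfolding test_functions_iff by blast
  have "\<exists>F. \<forall>x. - \<infinity> < ereal x \<longrightarrow> ereal x < \<infinity> \<longrightarrow> (F has_vector_derivative \<eta> x) (at x)"
    by (rule einterval_antiderivative) (use smooth_has_deriv[OF \<open>smooth \<eta>\<close>] DERIV_isCont in auto)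
  then obtain F where F: "\<And>x. (F has_real_derivative \<eta> x) (at x)"
    by (auto simp: has_real_derivative_iff_has_vector_derivative)
  then have F': "((\<lambda>x. complex_of_real (F x)) has_vector_derivative complex_of_real (\<eta> x)) (at x)" for x
    by (intro has_vector_derivative_of_real) (simp add: has_real_derivative_iff_has_vector_derivative)
  have "antideriv (\<lambda>x. complex_of_real (F x)) (\<lambda>x. complex_of_real (\<eta> x))"
    by (rule antideriv_C1[OF F' test_function_continuous[OF \<eta>]])
  from antideriv_integral[OF this] 0 have F01: "F 1 = F 0"
    by (metis eq_iff_diff_eq_0 of_real_eq_iff)
  have left: "F x = F 0" if "x < a" for x
  proof -
    have "\<exists>c. \<forall>x\<in>{..<a}. F x = c"
      by (rule has_field_derivative_zero_constant)
        (use F ab(3) in \<open>auto intro: has_field_derivative_at_within\<close>,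
         metis F ab(3) atLeastAtMost_iff has_field_derivative_at_within linorder_not_less)
    then show ?thesis using that ab by auto
  qed
  have right: "F x = F 0" if "b < x" for x
  proof -
    have "\<exists>c. \<forall>x\<in>{b<..}. F x = c"
      by (rule has_field_derivative_zero_constant, simp)
        (metis F ab(3) atLeastAtMost_iff greaterThan_iff has_field_derivative_at_within linorder_not_less)
    then show ?thesis using that ab F01 by auto
  qed
  define \<phi> where "\<phi> x = F x - F 0" for x
  have \<phi>: "(\<phi> has_real_derivative \<eta> x) (at x)" for x
    unfolding \<phi>_def using DERIV_diff[OF F DERIV_const] by simp
  have "\<forall>x. x \<notin> {a..b} \<longrightarrow> \<phi> x = 0"
    using left right by (auto simp: \<phi>_def not_le)
  with smooth_primitive[OF \<phi> \<open>smooth \<eta>\<close>] ab(1,2) have "\<phi> \<in> test_functions"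
    unfolding test_functions_iff by blast
  moreover have "deriv \<phi> = \<eta>"
    using \<phi> by (intro ext DERIV_imp_deriv)
  ultimately show thesis by (rule that)
qed

text \<open>Every test function becomes the derivative of a test function after its mean is removed
  by a multiple of one fixed \<theta>. Testing with the corrected function shows that
  \<open>u - c\<close> is orthogonal to all test functions.\<close>

lemma du_Bois_Reymond:
  fixes u :: "real \<Rightarrow> complex"
  assumes u: "integrable unit_meas u"
    and test: "\<And>\<phi>. \<phi> \<in> test_functions \<Longrightarrow> (LINT x|unit_meas. u x * complex_of_real (deriv \<phi> x)) = 0"
  obtains c where "AE x in unit_meas. u x = c"
proof -
  \<comment> \<open>If all test functions had mean zero, the fundamental lemma would make the
    constant 1 vanish almost everywhere.\<close>
  have "\<exists>\<theta>\<in>test_functions. (LINT x|unit_meas. complex_of_real (\<theta> x)) \<noteq> 0"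
  proof (rule ccontr)
    assume "\<not> ?thesis"
    then have "AE x in unit_meas. (1::complex) = 0"
      by (intro fundamental_lemma) auto
    then have "AE x in unit_meas. False" by simp
    then have "emeasure unit_meas (space unit_meas) = 0"
      unfolding ae_filter_eq_bot_iff[symmetric] trivial_limit_def .
    then show False
      using measure_unit_meas by (simp add: measure_def)
  qed
  then obtain \<theta> where \<theta>: "\<theta> \<in> test_functions" and "(LINT x|unit_meas. complex_of_real (\<theta> x)) \<noteq> 0"
    by blast
  define I where "I = (LINT x|unit_meas. \<theta> x)"
  have I: "(LINT x|unit_meas. complex_of_real (\<theta> x)) = complex_of_real I" "I \<noteq> 0"
    using \<open>_ \<noteq> 0\<close> by (auto simp: I_def)
  have int: "integrable unit_meas (\<lambda>x. complex_of_real (\<psi> x))"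
    "integrable unit_meas (\<lambda>x. u x * complex_of_real (\<psi> x))" if "\<psi> \<in> test_functions" for \<psi>
    using that by (auto intro: integrable_continuous_unit_meas integrable_mult_continuous[OF u]
        test_function_continuous)
  \<comment> \<open>The constant is forced: it is the average of \<open>u\<close> with weight
    \<theta>.\<close>
  define c where "c = (LINT x|unit_meas. u x * complex_of_real (\<theta> x)) / I"
  have "AE x in unit_meas. u x - c = 0"
  proof (rule fundamental_lemma)
    show "integrable unit_meas (\<lambda>x. u x - c)"
      using u by simp
    fix \<psi> assume \<psi>: "\<psi> \<in> test_functions"
    define k where "k = (LINT x|unit_meas. \<psi> x)"
    let ?\<eta> = "\<lambda>x. \<psi> x + (- k / I) * \<theta> x"
    have \<eta>: "?\<eta> \<in> test_functions"
      by (rule test_function_lincomb[OF \<psi> \<theta>])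
    have "(LINT x|unit_meas. complex_of_real (?\<eta> x)) =
        (LINT x|unit_meas. complex_of_real (\<psi> x) + (- k / I) * complex_of_real (\<theta> x))"
      by simp
    also have "\<dots> = complex_of_real k + (- k / I) * complex_of_real I"
      using int[OF \<psi>] int[OF \<theta>] by (subst Bochner_Integration.integral_add) (auto simp: k_def I_def simp del: of_real_minus)
    also have "\<dots> = 0" using I by simp
    finally obtain \<phi> where "\<phi> \<in> test_functions" "deriv \<phi> = ?\<eta>"
      by (rule test_function_primitive[OF \<eta>])
    with test[of \<phi>] have "0 = (LINT x|unit_meas. u x * complex_of_real (?\<eta> x))"
      by simp
    also have "\<dots> = (LINT x|unit_meas. u x * complex_of_real (\<psi> x) + (- k / I) * (u x * complex_of_real (\<theta> x)))"
      by (simp add: algebra_simps)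
    also have "\<dots> = (LINT x|unit_meas. u x * complex_of_real (\<psi> x)) + (- k / I) * (LINT x|unit_meas. u x * complex_of_real (\<theta> x))"
      using int[OF \<psi>] int[OF \<theta>] by (subst Bochner_Integration.integral_add) (auto simp del: of_real_minus)
    also have "\<dots> = (LINT x|unit_meas. u x * complex_of_real (\<psi> x)) - c * k"
      by (simp add: c_def)
    also have "\<dots> = (LINT x|unit_meas. (u x - c) * complex_of_real (\<psi> x))"
      using int[OF \<psi>] by (simp add: left_diff_distrib Bochner_Integration.integral_diff k_def)
    finally show "(LINT x|unit_meas. (u x - c) * complex_of_real (\<psi> x)) = 0" ..
  qed
  then show thesis
    by (intro that[of c]) auto
qed

section \<open>Square-integrable functions on the unit interval\<close>

lemma L2_measurable: "f \<in> L2 \<Longrightarrow> f \<in> borel_measurable unit_meas"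
  by (simp add: L2_def)

lemma L2_integrable_square: "f \<in> L2 \<Longrightarrow> integrable unit_meas (\<lambda>x. (norm (f x))\<^sup>2)"
  by (simp add: L2_def)

lemma cnj_measurable [measurable]: "cnj \<in> borel_measurable borel"
  by (intro borel_measurable_continuous_onI continuous_intros)

lemma L2_integrable_mult:
  assumes "f \<in> L2" "g \<in> L2"
  shows "integrable unit_meas (\<lambda>x. f x * cnj (g x))"
proof (rule Bochner_Integration.integrable_bound)
  have [measurable]: "f \<in> borel_measurable unit_meas" "g \<in> borel_measurable unit_meas"
    using assms by (auto intro: L2_measurable)
  show "integrable unit_meas (\<lambda>x. (norm (f x))\<^sup>2 + (norm (g x))\<^sup>2)"
    by (intro Bochner_Integration.integrable_add L2_integrable_square assms)
  show "(\<lambda>x. f x * cnj (g x)) \<in> borel_measurable unit_meas"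
    by measurable
  show "AE x in unit_meas. norm (f x * cnj (g x)) \<le> norm ((norm (f x))\<^sup>2 + (norm (g x))\<^sup>2)"
  proof (rule AE_I2)
    fix x
    have "0 \<le> (norm (f x) - norm (g x))\<^sup>2" "0 \<le> (norm (f x))\<^sup>2" "0 \<le> (norm (g x))\<^sup>2"
      by auto
    then show "norm (f x * cnj (g x)) \<le> norm ((norm (f x))\<^sup>2 + (norm (g x))\<^sup>2)"
      unfolding norm_mult complex_mod_cnj real_norm_def power2_diff by linarith
  qed
qed

lemma continuous_L2:
  assumes "continuous_on {0..1} f"
  shows "f \<in> L2"
proof -
  have "integrable unit_meas (\<lambda>x. f x * cnj (f x))"
    by (intro integrable_continuous_unit_meas continuous_intros assms)
  then have "integrable unit_meas (\<lambda>x. norm (f x * cnj (f x)))"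
    by (rule Bochner_Integration.integrable_norm)
  then show ?thesis
    using continuous_measurable_unit_meas[OF assms] by (simp add: L2_def norm_mult power2_eq_square)
qed

lemma L2_integrable: "f \<in> L2 \<Longrightarrow> integrable unit_meas f"
  using L2_integrable_mult[of f "\<lambda>x. 1"] continuous_L2[of "\<lambda>x. 1"] by simp

lemma L2_cmult:
  assumes "f \<in> L2" shows "(\<lambda>x. c * f x) \<in> L2"
  using assms by (auto simp: L2_def norm_mult power_mult_distrib)

lemma L2_add:
  assumes "f \<in> L2" "g \<in> L2" shows "(\<lambda>x. f x + g x) \<in> L2"
proof -
  have [measurable]: "f \<in> borel_measurable unit_meas" "g \<in> borel_measurable unit_meas"
    using assms by (auto intro: L2_measurable)
  have "integrable unit_meas (\<lambda>x. (norm (f x + g x))\<^sup>2)"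
  proof (rule Bochner_Integration.integrable_bound)
    show "integrable unit_meas (\<lambda>x. 2 * (norm (f x))\<^sup>2 + 2 * (norm (g x))\<^sup>2)"
      using assms by (intro Bochner_Integration.integrable_add integrable_mult_right L2_integrable_square)
    show "AE x in unit_meas. norm ((norm (f x + g x))\<^sup>2) \<le> norm (2 * (norm (f x))\<^sup>2 + 2 * (norm (g x))\<^sup>2)"
    proof (rule AE_I2)
      fix x
      have "(norm (f x + g x))\<^sup>2 \<le> (norm (f x) + norm (g x))\<^sup>2"
        by (intro power_mono norm_triangle_ineq norm_ge_zero)
      moreover have "0 \<le> (norm (f x) - norm (g x))\<^sup>2" "0 \<le> (norm (f x))\<^sup>2" "0 \<le> (norm (g x))\<^sup>2"
        "0 \<le> (norm (f x + g x))\<^sup>2" by auto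
      ultimately show "norm ((norm (f x + g x))\<^sup>2) \<le> norm (2 * (norm (f x))\<^sup>2 + 2 * (norm (g x))\<^sup>2)"
        unfolding real_norm_def power2_diff power2_sum by linarith
    qed
  qed measurable
  then show ?thesis by (simp add: L2_def)
qed

text \<open>A null set has empty interior, so the points of agreement are dense, and they form a
  closed set. The conclusion reaches 0 and 1, which the measure does not see; boundary values depend
  on this.\<close>

lemma continuous_AE_eq_imp_eq:
  fixes f g :: "real \<Rightarrow> complex"
  assumes f: "continuous_on {0..1} f" and g: "continuous_on {0..1} g"
    and ae: "AE x in unit_meas. f x = g x" and x: "x \<in> {0..1}"
  shows "f x = g x"
proof -
  have "AE x in lebesgue. x \<in> {0<..<1} \<longrightarrow> f x = g x"
    using ae by (subst (asm) AE_restrict_space_iff) auto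
  then obtain N where N: "{x. \<not> (x \<in> {0<..<1} \<longrightarrow> f x = g x)} \<subseteq> N" "N \<in> null_sets lebesgue"
    by (auto elim!: AE_E simp: null_sets_def)
  have "interior N = {}"
    using open_not_negligible[OF open_interior] negligible_subset[OF _ interior_subset] N(2)
    unfolding negligible_iff_null_sets by blast
  then have "closure (- N) = UNIV"
    by (simp add: closure_interior)
  then have "closure ({0<..<1} \<inter> - N) = {0..1}"
    using closure_open_Int_superset[of "{0<..<1::real}" "- N"] by simp
  moreover have "closed {x \<in> {0..1}. f x - g x = 0}"
    by (intro continuous_closed_preimage_constant continuous_intros f g)
  moreover have "{0<..<1} \<inter> - N \<subseteq> {x \<in> {0..1}. f x - g x = 0}"
    using N(1) by auto
  ultimately show ?thesis
    using closure_minimal[of "{0<..<1} \<inter> - N" "{x \<in> {0..1}. f x - g x = 0}"] x by auto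
qed

text \<open>Integration by parts; the boundary terms drop out because a test function vanishes at 0
  and 1.\<close>

lemma antideriv_weak:
  assumes w: "antideriv w u" and \<phi>: "\<phi> \<in> test_functions"
  shows "(LINT x|unit_meas. w x * complex_of_real (deriv \<phi> x)) = - (LINT x|unit_meas. u x * complex_of_real (\<phi> x))"
proof -
  note c = test_function_continuous[OF \<phi>] test_function_continuous[OF test_function_deriv[OF \<phi>]]
  have i: "integrable unit_meas (\<lambda>x. u x * complex_of_real (\<phi> x))"
    "integrable unit_meas (\<lambda>x. w x * complex_of_real (deriv \<phi> x))"
    by (intro integrable_mult_continuous antideriv_integrable[OF w] c integrable_continuous_unit_meas
       continuous_on_mult antideriv_continuous[OF w])+
  have "antideriv (\<lambda>x. w x * complex_of_real (\<phi> x))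
      (\<lambda>x. u x * complex_of_real (\<phi> x) + w x * complex_of_real (deriv \<phi> x))"
    by (rule antideriv_mult[OF w test_function_vector_derivative[OF \<phi>] c(2)])
  from antideriv_integral[OF this] show ?thesis
    by (simp add: Bochner_Integration.integral_add[OF i] test_function_endpoints[OF \<phi>] add_eq_0_iff)
qed

lemma weak_deriv_unique:
  assumes "integrable unit_meas g" "integrable unit_meas h" "is_weak_deriv j y g" "is_weak_deriv j y h"
  shows "ae_eq g h"
proof -
  have "AE x in unit_meas. g x - h x = 0"
  proof (rule fundamental_lemma)
    show "integrable unit_meas (\<lambda>x. g x - h x)"
      using assms by auto
    fix \<phi> assume \<phi>: "\<phi> \<in> test_functions"
    have "(-1) ^ j * (LINT x|unit_meas. g x * complex_of_real (\<phi> x)) =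
        (-1) ^ j * (LINT x|unit_meas. h x * complex_of_real (\<phi> x))"
      using bspec[OF assms(3)[unfolded is_weak_deriv_def] \<phi>]
        bspec[OF assms(4)[unfolded is_weak_deriv_def] \<phi>] by simp
    then show "(LINT x|unit_meas. (g x - h x) * complex_of_real (\<phi> x)) = 0"
      using integrable_mult_continuous[OF assms(1) test_function_continuous[OF \<phi>]]
       integrable_mult_continuous[OF assms(2) test_function_continuous[OF \<phi>]]
      by (simp add: left_diff_distrib Bochner_Integration.integral_diff)
  qed
  then show ?thesis by (simp add: ae_eq_def)
qed

text \<open>The difference \<open>y - prim g\<close> has weak derivative zero and is therefore
  almost everywhere constant. This supplies the absolutely continuous representative of
  \<open>y\<close>.\<close>

lemma weak_deriv_imp_antideriv:
  assumes y: "integrable unit_meas y" and g: "integrable unit_meas g" and weak: "is_weak_deriv 1 y g"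
  obtains w where "antideriv w g" "ae_eq y w"
proof -
  have p: "antideriv (prim g) g"
    using antideriv_prim[OF g, of 0] by simp
  have ip: "integrable unit_meas (prim g)"
    by (intro integrable_continuous_unit_meas continuous_prim g)
  obtain c where "AE x in unit_meas. y x - prim g x = c"
  proof (rule du_Bois_Reymond)
    show "integrable unit_meas (\<lambda>x. y x - prim g x)"
      using y ip by auto
    fix \<phi> assume \<phi>: "\<phi> \<in> test_functions"
    note c = test_function_continuous[OF test_function_deriv[OF \<phi>]]
    show "(LINT x|unit_meas. (y x - prim g x) * complex_of_real (deriv \<phi> x)) = 0"
      using weak \<phi> antideriv_weak[OF p \<phi>]
      by (simp add: left_diff_distrib is_weak_deriv_def
          Bochner_Integration.integral_diff[OF integrable_mult_continuous[OF y c] integrable_mult_continuous[OF ip c]])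
  qed
  then have "ae_eq y (\<lambda>x. c + prim g x)"
    unfolding ae_eq_def by eventually_elim (simp add: algebra_simps)
  with antideriv_prim[OF g] show thesis by (rule that)
qed

section \<open>The domain described by chains of periodic primitives\<close>

definition periodic_antideriv :: "(real \<Rightarrow> complex) \<Rightarrow> (real \<Rightarrow> complex) \<Rightarrow> bool" where
  "periodic_antideriv w u \<longleftrightarrow> antideriv w u \<and> w 1 = w 0"

lemma periodic_antideriv_periodic_bc:
  "periodic_antideriv w u \<Longrightarrow> ae_eq y w \<Longrightarrow> periodic_bc y"
  unfolding periodic_antideriv_def periodic_bc_def using antideriv_continuous by blast

lemma periodic_bc_periodic_antideriv:
  assumes "antideriv w u" "ae_eq y w" "periodic_bc y"
  shows "periodic_antideriv w u"
proof -
  obtain w' where w': "continuous_on {0..1} w'" "ae_eq y w'" "w' 1 = w' 0"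
    using assms(3) unfolding periodic_bc_def by blast
  have ae: "AE x in unit_meas. w x = w' x"
    using assms(2) w'(2) unfolding ae_eq_def by eventually_elim simp
  note eq = continuous_AE_eq_imp_eq[OF antideriv_continuous[OF assms(1)] w'(1) ae]
  show ?thesis
    unfolding periodic_antideriv_def using assms(1) eq[of 0] eq[of 1] w'(3) by simp
qed

lemma weak_deriv_properties:
  assumes "g \<in> L2" "is_weak_deriv j y g"
  shows "weak_deriv j y \<in> L2" "is_weak_deriv j y (weak_deriv j y)" "ae_eq (weak_deriv j y) g"
proof -
  have "weak_deriv j y \<in> L2 \<and> is_weak_deriv j y (weak_deriv j y)"
    unfolding weak_deriv_def by (rule someI[of _ g]) (use assms in simp)
  then show 1: "weak_deriv j y \<in> L2" "is_weak_deriv j y (weak_deriv j y)" by auto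
  show "ae_eq (weak_deriv j y) g"
    by (rule weak_deriv_unique[OF L2_integrable[OF 1(1)] L2_integrable[OF assms(1)] 1(2) assms(2)])
qed

lemma dom_L_I:
  assumes w: "periodic_antideriv w0 w1" "periodic_antideriv w1 w2" "periodic_antideriv w2 w3"
    and w3: "w3 \<in> L2"
  shows "w0 \<in> dom_L" "ae_eq (weak_deriv 3 w0) w3"
proof -
  have a: "antideriv w0 w1" "antideriv w1 w2" "antideriv w2 w3"
    using w by (auto simp: periodic_antideriv_def)
  have d0: "is_weak_deriv 0 w0 w0"
    by (simp add: is_weak_deriv_def)
  have d1: "is_weak_deriv 1 w0 w1"
    using antideriv_weak[OF a(1)] by (simp add: is_weak_deriv_def)
  have d2: "is_weak_deriv 2 w0 w2"
    using antideriv_weak[OF a(1)] antideriv_weak[OF a(2)] test_function_deriv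
    by (simp add: is_weak_deriv_def numeral_2_eq_2)
  have d3: "is_weak_deriv 3 w0 w3"
    using antideriv_weak[OF a(1)] antideriv_weak[OF a(2)] antideriv_weak[OF a(3)] test_function_deriv
    by (simp add: is_weak_deriv_def numeral_3_eq_3)
  have L: "w0 \<in> L2" "w1 \<in> L2" "w2 \<in> L2"
    using a by (auto intro: continuous_L2 antideriv_continuous)
  have "\<exists>g\<in>L2. is_weak_deriv j w0 g" if "j \<le> 3" for j
  proof -
    have "j = 0 \<or> j = 1 \<or> j = 2 \<or> j = 3" using that by auto
    then show ?thesis using d0 d1 d2 d3 L w3 by blast
  qed
  then have "w0 \<in> sobolev 3"
    using L by (simp add: sobolev_def)
  moreover have "periodic_bc w0"
    by (rule periodic_antideriv_periodic_bc[OF w(1)]) (simp add: ae_eq_def)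
  moreover have "periodic_bc (weak_deriv 1 w0)"
    by (rule periodic_antideriv_periodic_bc[OF w(2)]) (rule weak_deriv_properties[OF L(2) d1])
  moreover have "periodic_bc (weak_deriv 2 w0)"
    by (rule periodic_antideriv_periodic_bc[OF w(3)]) (rule weak_deriv_properties[OF L(3) d2])
  ultimately show "w0 \<in> dom_L" by (simp add: dom_L_def)
  show "ae_eq (weak_deriv 3 w0) w3"
    by (rule weak_deriv_properties[OF w3 d3])
qed

text \<open>Test functions are closed under \<open>deriv\<close>, so consecutive weak derivatives of
  \<open>y\<close> are first weak derivatives of one another, and each has an absolutely continuous
  representative. These representatives form the chain.\<close>

lemma dom_L_E:
  assumes "y \<in> dom_L"
  obtains w0 w1 w2 where "ae_eq y w0" "periodic_antideriv w0 w1" "periodic_antideriv w1 w2"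
    "periodic_antideriv w2 (weak_deriv 3 y)" "weak_deriv 3 y \<in> L2"
proof -
  have y: "y \<in> L2" and ex: "\<And>j. j \<le> 3 \<Longrightarrow> \<exists>g\<in>L2. is_weak_deriv j y g"
    and bc: "periodic_bc y" "periodic_bc (weak_deriv 1 y)" "periodic_bc (weak_deriv 2 y)"
    using assms by (auto simp: dom_L_def sobolev_def)
  have L: "weak_deriv j y \<in> L2" and d: "is_weak_deriv j y (weak_deriv j y)" if "j \<le> 3" for j
    using ex[OF that] weak_deriv_properties by blast+
  have L1: "weak_deriv 1 y \<in> L2" and L2: "weak_deriv 2 y \<in> L2" and L3: "weak_deriv 3 y \<in> L2"
    using L by auto
  have d1: "is_weak_deriv 1 y (weak_deriv 1 y)" and d2: "is_weak_deriv 2 y (weak_deriv 2 y)"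
    and d3: "is_weak_deriv 3 y (weak_deriv 3 y)"
    using d by auto
  have d12: "is_weak_deriv 1 (weak_deriv 1 y) (weak_deriv 2 y)"
    unfolding is_weak_deriv_def
  proof
    \<comment> \<open>Testing the first derivative of \<open>y\<close> with
      \<open>deriv \<phi>\<close> and the second with \<phi> produces the same integral of
      \<open>y\<close>.\<close>
    fix \<phi> assume \<phi>: "\<phi> \<in> test_functions"
    show "(LINT x|unit_meas. weak_deriv 1 y x * complex_of_real ((deriv ^^ 1) \<phi> x)) =
        (- 1) ^ 1 * (LINT x|unit_meas. weak_deriv 2 y x * complex_of_real (\<phi> x))"
      using bspec[OF d1[unfolded is_weak_deriv_def] test_function_deriv[OF \<phi>]]
        bspec[OF d2[unfolded is_weak_deriv_def] \<phi>]
      by (simp add: numeral_2_eq_2) (metis minus_minus)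
  qed
  have d23: "is_weak_deriv 1 (weak_deriv 2 y) (weak_deriv 3 y)"
    unfolding is_weak_deriv_def
  proof
    fix \<phi> assume \<phi>: "\<phi> \<in> test_functions"
    show "(LINT x|unit_meas. weak_deriv 2 y x * complex_of_real ((deriv ^^ 1) \<phi> x)) =
        (- 1) ^ 1 * (LINT x|unit_meas. weak_deriv 3 y x * complex_of_real (\<phi> x))"
      using bspec[OF d2[unfolded is_weak_deriv_def] test_function_deriv[OF \<phi>]]
        bspec[OF d3[unfolded is_weak_deriv_def] \<phi>]
      by (simp add: numeral_2_eq_2 numeral_3_eq_3)
  qed
  note i = L2_integrable[OF y] L2_integrable[OF L1] L2_integrable[OF L2] L2_integrable[OF L3]
  obtain w0 where w0: "antideriv w0 (weak_deriv 1 y)" "ae_eq y w0"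
    by (rule weak_deriv_imp_antideriv[OF i(1,2) d1])
  obtain w1 where w1: "antideriv w1 (weak_deriv 2 y)" "ae_eq (weak_deriv 1 y) w1"
    by (rule weak_deriv_imp_antideriv[OF i(2,3) d12])
  obtain w2 where w2: "antideriv w2 (weak_deriv 3 y)" "ae_eq (weak_deriv 2 y) w2"
    by (rule weak_deriv_imp_antideriv[OF i(3,4) d23])
  \<comment> \<open>The integrand is replaced by its continuous representative, so that consecutive
    links of the chain share the same function.\<close>
  have a01: "antideriv w0 w1"
    by (rule antideriv_cong_AE[OF w0(1)])
      (use w1 in \<open>auto simp: ae_eq_def intro: integrable_continuous_unit_meas antideriv_continuous\<close>)
  have a12: "antideriv w1 w2"
    by (rule antideriv_cong_AE[OF w1(1)])
      (use w2 in \<open>auto simp: ae_eq_def intro: integrable_continuous_unit_meas antideriv_continuous\<close>)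
  show thesis
    by (rule that[OF w0(2) periodic_bc_periodic_antideriv[OF a01 w0(2) bc(1)]
          periodic_bc_periodic_antideriv[OF a12 w1(2) bc(2)]
          periodic_bc_periodic_antideriv[OF w2 bc(3)] L3])
qed

section \<open>Completeness of the trigonometric system\<close>

text \<open>A general complex rate is allowed because two of the factors of the third-order equation
  have exponents off the imaginary axis when \<open>n \<noteq> 0\<close>.\<close>

definition expo :: "complex \<Rightarrow> real \<Rightarrow> complex" where
  "expo \<kappa> x = exp (\<kappa> * complex_of_real x)"

text \<open>In these terms the eigenvalue \<open>(2 * pi * k) ^ 3\<close> reads
  \<open>\<i> * freq k ^ 3\<close>.\<close>

definition freq :: "int \<Rightarrow> complex" where
  "freq k = \<i> * complex_of_real (2 * pi * of_int k)"

lemma expo_0_right [simp]: "expo \<kappa> 0 = 1"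
  by (simp add: expo_def)

lemma expo_0_left [simp]: "expo 0 = (\<lambda>x. 1)"
  by (simp add: expo_def fun_eq_iff)

lemma expo_add: "expo (\<kappa> + \<mu>) x = expo \<kappa> x * expo \<mu> x"
  by (simp add: expo_def exp_add distrib_right)

lemma expo_minus_mult [simp]: "expo (- \<kappa>) x * expo \<kappa> x = 1" "expo \<kappa> x * expo (- \<kappa>) x = 1"
  by (simp_all flip: expo_add)

lemma continuous_expo [continuous_intros]: "continuous_on A (expo \<kappa>)"
  unfolding expo_def by (intro continuous_intros)

lemma expo_deriv: "(expo \<kappa> has_vector_derivative \<kappa> * expo \<kappa> x) (at x)"
proof -
  have "((\<lambda>z. exp (\<kappa> * z)) has_field_derivative \<kappa> * exp (\<kappa> * of_real x)) (at (of_real x))"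
    by (auto intro!: derivative_eq_intros)
  then show ?thesis
    unfolding expo_def by (rule has_vector_derivative_real_field)
qed

lemma freq_add: "freq (k + l) = freq k + freq l"
  by (simp add: freq_def algebra_simps)

lemma freq_minus: "freq (- k) = - freq k"
  by (simp add: freq_def)

lemma freq_0 [simp]: "freq 0 = 0"
  by (simp add: freq_def)

lemma expo_freq_1 [simp]: "expo (freq k) 1 = 1"
proof -
  have "exp (of_real (2 * of_int k * pi) * \<i>) = (1::complex)"
    using exp_integer_2pi[of "of_int k"] by simp
  then show ?thesis by (simp add: expo_def freq_def mult_ac)
qed

lemma expo_minus_freq_1 [simp]: "expo (- freq k) 1 = 1"
  using expo_freq_1[of "- k"] by (simp add: freq_minus)

lemma cnj_expo_freq [simp]: "cnj (expo (freq k) x) = expo (- freq k) x"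
  by (simp add: expo_def exp_cnj freq_def)

lemma norm_expo_freq [simp]: "norm (expo (freq k) x) = 1"
  by (simp add: expo_def freq_def)

inductive_set trig_polys :: "(real \<Rightarrow> complex) set" where
  expo: "expo (freq k) \<in> trig_polys"
| cmult: "f \<in> trig_polys \<Longrightarrow> (\<lambda>x. c * f x) \<in> trig_polys"
| add: "f \<in> trig_polys \<Longrightarrow> g \<in> trig_polys \<Longrightarrow> (\<lambda>x. f x + g x) \<in> trig_polys"

lemma trig_polys_const: "(\<lambda>x. c) \<in> trig_polys"
  using trig_polys.cmult[OF trig_polys.expo[of 0], of c] by simp

lemma trig_polys_mult:
  assumes "f \<in> trig_polys" "g \<in> trig_polys"
  shows "(\<lambda>x. f x * g x) \<in> trig_polys"
  using assms
proof (induction f)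
  case (expo k)
  from expo show ?case
  proof (induction g)
    case (expo l)
    then show ?case
      using trig_polys.expo[of "k + l"] by (simp add: freq_add expo_add[abs_def])
  next
    case (cmult g c)
    then show ?case
      using trig_polys.cmult[of _ c] by (simp add: mult.left_commute)
  next
    case (add g h)
    then show ?case
      using trig_polys.add by (simp add: distrib_left)
  qed
next
  case (cmult f c)
  then show ?case
    using trig_polys.cmult[of _ c] by (simp add: mult.assoc)
next
  case (add f h)
  then show ?case
    using trig_polys.add by (simp add: distrib_right)
qed

text \<open>A real-linear functional on the plane is a combination of \<open>z\<close> and its
  conjugate, and on the unit circle the conjugate of \<open>expo (freq 1) x\<close> is
  \<open>expo (freq (- 1)) x\<close>. Sums and products then stay within the trigonometric
  polynomials.\<close>

lemma trig_polys_real_polynomial_function: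
  assumes "real_polynomial_function g"
  shows "(\<lambda>x. complex_of_real (g (expo (freq 1) x))) \<in> trig_polys"
  using assms
proof induction
  case (linear g)
  interpret bounded_linear g by fact
  \<comment> \<open>The coefficients come from \<open>Re z = (z + cnj z) / 2\<close> and
    \<open>Im z = (z - cnj z) / (2 * \<i>)\<close>.\<close>
  have eq: "complex_of_real (g (expo (freq 1) x)) =
      ((g 1 - \<i> * g \<i>) / 2) * expo (freq 1) x + ((g 1 + \<i> * g \<i>) / 2) * expo (freq (- 1)) x" for x
  proof -
    let ?z = "expo (freq 1) x"
    have "?z = Re ?z *\<^sub>R 1 + Im ?z *\<^sub>R \<i>"
      by (simp add: complex_eq_iff)
    then have "g ?z = Re ?z * g 1 + Im ?z * g \<i>"
      by (metis add scaleR real_scaleR_def)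
    moreover have "expo (freq (- 1)) x = Complex (Re ?z) (- Im ?z)"
      by (simp add: freq_minus complex_eq_iff flip: cnj_expo_freq)
    ultimately show ?thesis
      by (simp add: complex_eq_iff field_simps)
  qed
  show ?case
    unfolding eq by (intro trig_polys.intros)
next
  case (const c)
  show ?case by (rule trig_polys_const)
next
  case (add f g)
  then show ?case using trig_polys.add by simp
next
  case (mult f g)
  then show ?case using trig_polys_mult by simp
qed

lemma trig_polys_orthogonal:
  assumes "h \<in> trig_polys" and v: "integrable unit_meas v"
    and 0: "\<And>k. (LINT x|unit_meas. v x * expo (freq k) x) = 0"
  shows "continuous_on {0..1} h \<and> (LINT x|unit_meas. v x * h x) = 0"
  using assms(1)
proof induction
  case (expo k)
  then show ?case by (simp add: 0 continuous_expo)
next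
  case (cmult f c)
  have "(LINT x|unit_meas. v x * (c * f x)) = c * (LINT x|unit_meas. v x * f x)"
    by (subst integral_mult_right_zero[symmetric]) (simp add: mult_ac)
  with cmult show ?case by (auto intro: continuous_intros)
next
  case (add f g)
  then show ?case
    by (auto intro: continuous_intros simp: distrib_left
        Bochner_Integration.integral_add[OF integrable_mult_continuous[OF v] integrable_mult_continuous[OF v]])
qed

text \<open>The argument function jumps at the point 1 of the circle, but a test function vanishes
  near both ends of the interval, so its transport to the circle is still continuous.\<close>

lemma test_function_circle:
  assumes "\<psi> \<in> test_functions"
  obtains f where "continuous_on (sphere 0 1) f" "\<And>x. 0 < x \<Longrightarrow> x < 1 \<Longrightarrow> f (expo (freq 1) x) = \<psi> x"
proof -
  from assms obtain a b where ab: "0 < a" "b < 1" "\<And>x. x \<notin> {a..b} \<Longrightarrow> \<psi> x = 0" and "smooth \<psi>"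
    unfolding test_functions_iff by blast
  have cont: "isCont \<psi> x" for x
    using smooth_has_deriv[OF \<open>smooth \<psi>\<close>] by (rule DERIV_isCont)
  define f where "f z = \<psi> (Arg2pi z / (2 * pi))" for z
  define K where "K = expo (freq 1) ` {a..b}"
  have arg: "Arg2pi (expo (freq 1) x) = 2 * pi * x" if "0 \<le> x" "x < 1" for x
    by (rule Arg2pi_unique[where r = 1]) (use that in \<open>auto simp: expo_def freq_def mult_ac\<close>)
  have "1 \<notin> K"
  proof
    assume "1 \<in> K"
    then obtain x where x: "a \<le> x" "x \<le> b" "expo (freq 1) x = 1"
      unfolding K_def by auto
    with arg[of x] ab have "Arg2pi 1 = 2 * pi * x" by simp
    then show False using x ab Arg2pi_of_real[of 1] by simp
  qed
  have "closed K"
    unfolding K_def by (intro compact_imp_closed compact_continuous_image continuous_intros) auto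
  have zero: "f z = 0" if "z \<in> sphere 0 1" "z \<notin> K" for z
  proof -
    have "z = expo (freq 1) (Arg2pi z / (2 * pi))"
      using that Arg2pi_eq[of z] by (simp add: expo_def freq_def mult_ac)
    with that have "Arg2pi z / (2 * pi) \<notin> {a..b}"
      unfolding K_def by blast
    then show ?thesis
      unfolding f_def by (rule ab(3))
  qed
  have "continuous (at z within sphere 0 1) f" if z: "z \<in> sphere 0 1" for z
  proof (cases "z = 1")
    case True
    \<comment> \<open>The compact image \<open>K\<close> of the support misses 1, so
      \<open>f\<close> is zero near 1 on the circle.\<close>
    have "eventually (\<lambda>w. w \<in> - K) (nhds 1)"
      using \<open>closed K\<close> \<open>1 \<notin> K\<close> by (intro eventually_nhds_in_open) auto
    then have "eventually (\<lambda>w. f w = f 1) (at 1 within sphere 0 1)"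
      unfolding eventually_at_filter using zero[of 1] zero \<open>1 \<notin> K\<close> by (auto elim!: eventually_mono)
    with True show ?thesis
      unfolding continuous_within by (auto intro: tendsto_eventually)
  next
    case False
    have "z \<notin> \<real>\<^sub>\<ge>\<^sub>0"
      using False z by (auto elim!: nonneg_Reals_cases)
    then have "isCont Arg2pi z" by (rule continuous_at_Arg2pi)
    then have "isCont (\<lambda>z. Arg2pi z / (2 * pi)) z" by (intro continuous_intros) auto
    then have "isCont f z"
      unfolding f_def using cont by (rule isCont_o2)
    then show ?thesis by (rule continuous_at_imp_continuous_at_within)
  qed
  then have "continuous_on (sphere 0 1) f"
    by (simp add: continuous_on_eq_continuous_within)
  moreover have "f (expo (freq 1) x) = \<psi> x" if "0 < x" "x < 1" for x
    using that arg[of x] by (simp add: f_def)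
  ultimately show thesis by (rule that)
qed

text \<open>Stone-Weierstrass on the circle approximates a test function uniformly by trigonometric
  polynomials, whose pairing with \<open>v\<close> vanishes; the pairing with the test function is
  thus arbitrarily small.\<close>

lemma fourier_complete:
  assumes v: "integrable unit_meas v"
    and 0: "\<And>k. (LINT x|unit_meas. v x * expo (freq k) x) = 0"
  shows "AE x in unit_meas. v x = 0"
proof (rule fundamental_lemma[OF v])
  fix \<psi> assume \<psi>: "\<psi> \<in> test_functions"
  obtain f where f: "continuous_on (sphere 0 1) f" "\<And>x. 0 < x \<Longrightarrow> x < 1 \<Longrightarrow> f (expo (freq 1) x) = \<psi> x"
    using test_function_circle[OF \<psi>] by blast
  define N where "N = (LINT x|unit_meas. norm (v x))"
  have N: "0 \<le> N" by (simp add: N_def)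
  have bound: "norm (LINT x|unit_meas. v x * complex_of_real (\<psi> x)) \<le> e * N" if "e > 0" for e
  proof -
    obtain g where g: "real_polynomial_function g" "\<And>z. z \<in> sphere 0 1 \<Longrightarrow> \<bar>f z - g z\<bar> < e"
      using Stone_Weierstrass_real_polynomial_function[OF _ f(1) \<open>e > 0\<close>] by auto
    let ?g = "\<lambda>x. complex_of_real (g (expo (freq 1) x))"
    have h: "continuous_on {0..1} ?g" "(LINT x|unit_meas. v x * ?g x) = 0"
      using trig_polys_orthogonal[OF trig_polys_real_polynomial_function[OF g(1)] v 0] by auto
    note i = integrable_mult_continuous[OF v test_function_continuous[OF \<psi>]] integrable_mult_continuous[OF v h(1)]
    have "(LINT x|unit_meas. v x * complex_of_real (\<psi> x)) =
        (LINT x|unit_meas. v x * complex_of_real (\<psi> x) - v x * ?g x)"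
      using h(2) by (simp add: Bochner_Integration.integral_diff[OF i])
    also have "norm \<dots> \<le> (LINT x|unit_meas. e * norm (v x))"
    proof (rule Bochner_Integration.integral_norm_bound_integral)
      show "integrable unit_meas (\<lambda>x. v x * complex_of_real (\<psi> x) - v x * ?g x)"
        by (intro Bochner_Integration.integrable_diff i)
      show "integrable unit_meas (\<lambda>x. e * norm (v x))"
        using v by auto
      fix x assume "x \<in> space unit_meas"
      then have "\<bar>\<psi> x - g (expo (freq 1) x)\<bar> \<le> e"
        using g(2)[of "expo (freq 1) x"] f(2)[of x] by auto
      then have "norm (v x) * norm (complex_of_real (\<psi> x - g (expo (freq 1) x))) \<le> norm (v x) * e"
        by (intro mult_left_mono) (auto simp del: of_real_diff)
      then show "norm (v x * complex_of_real (\<psi> x) - v x * ?g x) \<le> e * norm (v x)"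
        by (simp only: of_real_diff right_diff_distrib[symmetric] norm_mult mult.commute[of e])
    qed
    finally show ?thesis by (simp add: N_def)
  qed
  show "(LINT x|unit_meas. v x * complex_of_real (\<psi> x)) = 0"
  proof (rule ccontr)
    assume "\<not> ?thesis"
    then have pos: "norm (LINT x|unit_meas. v x * complex_of_real (\<psi> x)) > 0" (is "?I > 0") by simp
    \<comment> \<open>The L^1 norm \<open>N\<close> may be zero, so the tolerance is formed with
      \<open>N + 1\<close>.\<close>
    have N1: "0 < N + 1"
      by (intro add_nonneg_pos N) auto
    have e: "0 < ?I / 2 / (N + 1)"
      using pos N1 by (intro divide_pos_pos) auto
    have "?I \<le> ?I / 2 / (N + 1) * N"
      by (rule bound[OF e])
    also have "\<dots> \<le> ?I / 2 / (N + 1) * (N + 1)"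
      by (rule mult_left_mono[OF _ less_imp_le[OF e]]) simp
    also have "\<dots> = ?I / 2"
      by (subst times_divide_eq_left) (rule nonzero_mult_div_cancel_right[OF less_imp_neq[OF N1, symmetric]])
    also have "\<dots> < ?I"
      using pos by simp
    finally show False by simp
  qed
qed

section \<open>Periodic solutions of linear equations with constant coefficients\<close>

lemma periodic_antideriv_add:
  "periodic_antideriv w u \<Longrightarrow> periodic_antideriv w' u' \<Longrightarrow>
    periodic_antideriv (\<lambda>x. w x + w' x) (\<lambda>x. u x + u' x)"
  by (simp add: periodic_antideriv_def antideriv_add)

lemma periodic_antideriv_cmult:
  "periodic_antideriv w u \<Longrightarrow> periodic_antideriv (\<lambda>x. c * w x) (\<lambda>x. c * u x)"
  by (simp add: periodic_antideriv_def antideriv_cmult)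

lemma periodic_antideriv_continuous: "periodic_antideriv w u \<Longrightarrow> continuous_on {0..1} w"
  by (auto simp: periodic_antideriv_def intro: antideriv_continuous)

section \<open>Comparison of the sup, L^1 and L^2 norms\<close>

lemma norm_integral_mult_le:
  fixes f h :: "real \<Rightarrow> complex"
  assumes f: "integrable unit_meas f" and h: "continuous_on {0..1} h"
    and B: "\<And>x. x \<in> {0..1} \<Longrightarrow> norm (h x) \<le> B"
  shows "(LINT x|unit_meas. norm (f x * h x)) \<le> B * (LINT x|unit_meas. norm (f x))"
proof -
  have "(LINT x|unit_meas. norm (f x * h x)) \<le> (LINT x|unit_meas. B * norm (f x))"
  proof (rule integral_mono)
    show "integrable unit_meas (\<lambda>x. norm (f x * h x))"
      by (intro Bochner_Integration.integrable_norm integrable_mult_continuous f h)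
    show "integrable unit_meas (\<lambda>x. B * norm (f x))"
      using f by auto
    fix x assume "x \<in> space unit_meas"
    then show "norm (f x * h x) \<le> B * norm (f x)"
      using B[of x] mult_right_mono[of "norm (h x)" B "norm (f x)"] by (simp add: norm_mult mult.commute)
  qed
  then show ?thesis by simp
qed

lemma integral_norm_le_bound:
  fixes h :: "real \<Rightarrow> complex"
  assumes h: "continuous_on {0..1} h" and B: "\<And>x. x \<in> {0..1} \<Longrightarrow> norm (h x) \<le> B"
  shows "(LINT x|unit_meas. norm (h x)) \<le> B"
  using norm_integral_mult_le[OF _ h B, of "\<lambda>x. 1"] by simp

lemma L2norm_le_bound:
  assumes h: "continuous_on {0..1} h" and B: "\<And>x. x \<in> {0..1} \<Longrightarrow> norm (h x) \<le> B"
  shows "L2norm h \<le> B"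
proof -
  have B0: "0 \<le> B"
    using B[of 0] norm_ge_zero[of "h 0"] by (metis atLeastAtMost_iff order_refl order_trans zero_le_one)
  have "(LINT x|unit_meas. norm (h x * h x)) \<le> B * B"
    using norm_integral_mult_le[OF integrable_continuous_unit_meas[OF h] h B]
      mult_left_mono[OF integral_norm_le_bound[OF h B] B0] by linarith
  then have "(LINT x|unit_meas. (norm (h x))\<^sup>2) \<le> B\<^sup>2"
    by (simp add: norm_mult power2_eq_square)
  then show ?thesis
    unfolding L2norm_def using B0 real_le_lsqrt by blast
qed

text \<open>The measure has total mass one, so this is the nonnegativity of the variance of
  \<open>norm (f x)\<close> about its mean \<open>m\<close>.\<close>

lemma integral_norm_le_L2norm:
  assumes f: "f \<in> L2"
  shows "(LINT x|unit_meas. norm (f x)) \<le> L2norm f"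
proof -
  define m where "m = (LINT x|unit_meas. norm (f x))"
  have i: "integrable unit_meas (\<lambda>x. norm (f x))" "integrable unit_meas (\<lambda>x. (norm (f x))\<^sup>2)"
    using L2_integrable[OF f] L2_integrable_square[OF f] by auto
  have "0 \<le> (LINT x|unit_meas. (norm (f x) - m)\<^sup>2)"
    by simp
  also have "\<dots> = (LINT x|unit_meas. (norm (f x))\<^sup>2 - (2 * m * norm (f x) - m\<^sup>2))"
    by (rule Bochner_Integration.integral_cong) (auto simp: power2_diff)
  also have "\<dots> = (LINT x|unit_meas. (norm (f x))\<^sup>2) - m\<^sup>2"
    using i by (simp add: Bochner_Integration.integral_diff power2_eq_square flip: m_def)
  finally have "m\<^sup>2 \<le> (LINT x|unit_meas. (norm (f x))\<^sup>2)" by simp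
  then show ?thesis
    unfolding L2norm_def m_def[symmetric] by (rule real_le_rsqrt)
qed

lemma norm_expo_le: "x \<in> {0..1} \<Longrightarrow> norm (expo \<kappa> x) \<le> exp (norm \<kappa>)"
proof -
  assume x: "x \<in> {0..1}"
  have "norm (expo \<kappa> x) \<le> exp (norm (\<kappa> * complex_of_real x))"
    unfolding expo_def by (rule norm_exp)
  also have "\<dots> \<le> exp (norm \<kappa>)"
    using x by (simp add: norm_mult mult_left_le)
  finally show ?thesis .
qed

text \<open>In the resonant case \<open>e\<^sup>\<kappa> = 1\<close> the free constant is used to make the solution
  orthogonal to the kernel, so that the equation can be solved repeatedly.\<close>
lemma periodic_first_order:
  obtains C where "0 \<le> C" "\<And>g. integrable unit_meas g \<Longrightarrow>
      expo \<kappa> 1 \<noteq> 1 \<or> (LINT x|unit_meas. g x * expo (- \<kappa>) x) = 0 \<Longrightarrow>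
      \<exists>w. periodic_antideriv w (\<lambda>x. \<kappa> * w x + g x) \<and>
        (\<forall>x\<in>{0..1}. norm (w x) \<le> C * (LINT x|unit_meas. norm (g x))) \<and>
        (expo \<kappa> 1 = 1 \<longrightarrow> (LINT x|unit_meas. w x * expo (- \<kappa>) x) = 0)"
proof -
  define M where "M = exp (norm \<kappa>)"
  define D where "D = (if expo \<kappa> 1 = 1 then 1 else norm (expo \<kappa> 1 / (1 - expo \<kappa> 1)))"
  have M: "0 \<le> M" and D: "0 \<le> D" by (auto simp: M_def D_def)
  show thesis
  \<comment> \<open>One factor \<open>M\<close> pays for passing from \<open>g\<close> to
    \<open>h\<close>, the other for multiplying by \<open>expo \<kappa>\<close>;
    \<open>D + 1\<close> bounds \<open>c + prim h\<close> relative to the L^1 norm of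
    \<open>h\<close>.\<close>
  proof (rule that[of "(D + 1) * M * M"])
    show "0 \<le> (D + 1) * M * M" using M D by simp
    fix g assume g: "integrable unit_meas g"
      and solv: "expo \<kappa> 1 \<noteq> 1 \<or> (LINT x|unit_meas. g x * expo (- \<kappa>) x) = 0"
    define h where "h x = g x * expo (- \<kappa>) x" for x
    let ?I = "LINT x|unit_meas. h x" and ?N = "LINT x|unit_meas. norm (h x)"
      and ?G = "LINT x|unit_meas. norm (g x)"
    have h: "integrable unit_meas h"
      unfolding h_def by (intro integrable_mult_continuous g continuous_intros)
    have N: "?N \<le> M * ?G"
      unfolding h_def M_def using norm_expo_le[of _ "- \<kappa>"]
      by (intro norm_integral_mult_le g continuous_intros) simp
    have p: "norm (prim h x) \<le> ?N" for x
      by (rule norm_prim_le[OF h])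
    have cp: "continuous_on {0..1} (prim h)" by (rule continuous_prim[OF h])
    \<comment> \<open>Without resonance \<open>c\<close> solves the periodicity condition
      \<open>(c + ?I) * expo \<kappa> 1 = c\<close>. With resonance periodicity holds for every
      \<open>c\<close>, because solvability says \<open>?I = 0\<close>, and \<open>c\<close> removes
      the mean of \<open>prim h\<close>.\<close>
    define c where "c = (if expo \<kappa> 1 = 1 then - (LINT x|unit_meas. prim h x)
        else expo \<kappa> 1 / (1 - expo \<kappa> 1) * ?I)"
    have c: "norm c \<le> D * ?N"
    proof (cases "expo \<kappa> 1 = 1")
      case True
      have "norm (LINT x|unit_meas. prim h x) \<le> (LINT x|unit_meas. norm (prim h x))"
        by (rule integral_norm_bound)
      also have "\<dots> \<le> ?N"
        by (rule integral_norm_le_bound[OF cp p])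
      finally show ?thesis using True by (simp add: c_def D_def)
    next
      case False
      then show ?thesis
        unfolding c_def D_def by (simp add: norm_mult norm_divide mult_left_mono divide_right_mono)
    qed
    \<comment> \<open>Variation of constants: \<open>w * expo (- \<kappa>)\<close> is a primitive of
      \<open>h\<close>.\<close>
    define w where "w x = (c + prim h x) * expo \<kappa> x" for x
    have "antideriv w (\<lambda>x. h x * expo \<kappa> x + (c + prim h x) * (\<kappa> * expo \<kappa> x))"
      unfolding w_def
      by (rule antideriv_mult[OF antideriv_prim[OF h] expo_deriv]) (intro continuous_intros)
    also have "(\<lambda>x. h x * expo \<kappa> x + (c + prim h x) * (\<kappa> * expo \<kappa> x)) = (\<lambda>x. \<kappa> * w x + g x)"
      by (auto simp: h_def w_def mult.assoc mult.left_commute)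
    finally have 1: "antideriv w (\<lambda>x. \<kappa> * w x + g x)" .
    have "w 1 = w 0"
    proof (cases "expo \<kappa> 1 = 1")
      case True
      then show ?thesis using solv by (simp add: w_def prim_1 h_def[abs_def])
    next
      case False
      then show ?thesis by (simp add: w_def prim_1 c_def field_simps)
    qed
    moreover have "norm (w x) \<le> (D + 1) * M * M * ?G" if x: "x \<in> {0..1}" for x
    proof -
      have "norm (c + prim h x) \<le> (D + 1) * ?N"
        using norm_triangle_ineq[of c "prim h x"] c p[of x] by (simp add: distrib_right)
      also have "\<dots> \<le> (D + 1) * (M * ?G)"
        using N D by (intro mult_left_mono) auto
      finally have "norm (c + prim h x) * norm (expo \<kappa> x) \<le> (D + 1) * (M * ?G) * M"
        using norm_expo_le[OF x, of \<kappa>] M D by (intro mult_mono) (auto simp: M_def)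
      then show ?thesis by (simp add: w_def norm_mult mult_ac)
    qed
    moreover have "(LINT x|unit_meas. w x * expo (- \<kappa>) x) = 0" if "expo \<kappa> 1 = 1"
    proof -
      have "(LINT x|unit_meas. w x * expo (- \<kappa>) x) = (LINT x|unit_meas. c + prim h x)"
        by (simp add: w_def mult.assoc)
      also have "\<dots> = c + (LINT x|unit_meas. prim h x)"
        by (subst Bochner_Integration.integral_add) (auto intro: integrable_continuous_unit_meas cp)
      finally show ?thesis using that by (simp add: c_def)
    qed
    ultimately show "\<exists>w. periodic_antideriv w (\<lambda>x. \<kappa> * w x + g x) \<and>
        (\<forall>x\<in>{0..1}. norm (w x) \<le> (D + 1) * M * M * ?G) \<and>
        (expo \<kappa> 1 = 1 \<longrightarrow> (LINT x|unit_meas. w x * expo (- \<kappa>) x) = 0)"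
      using 1 by (intro exI[of _ w]) (auto simp: periodic_antideriv_def)
  qed
qed

text \<open>Solved by the factorisation \<open>D\<^sup>3 - \<kappa>\<^sup>3 = (D - \<kappa>)(D - \<omega>\<kappa>)(D - \<omega>\<^sup>2\<kappa>)\<close> with \<open>\<omega>\<close> a primitive cube root of unity.\<close>
lemma periodic_third_order:
  obtains C where "0 \<le> C" "\<And>g. integrable unit_meas g \<Longrightarrow>
      (LINT x|unit_meas. g x * expo (- freq n) x) = 0 \<Longrightarrow>
      \<exists>w0 w1 w2. periodic_antideriv w0 w1 \<and> periodic_antideriv w1 w2 \<and>
        periodic_antideriv w2 (\<lambda>x. freq n ^ 3 * w0 x + g x) \<and>
        (\<forall>x\<in>{0..1}. norm (w0 x) \<le> C * (LINT x|unit_meas. norm (g x)))"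
proof -
  define \<omega> where "\<omega> = Complex (- 1 / 2) (sqrt 3 / 2)"
  have \<omega>: "1 + \<omega> + \<omega>\<^sup>2 = 0"
    by (simp add: \<omega>_def complex_eq_iff power2_eq_square)
  define \<kappa> where "\<kappa> = freq n"
  define \<kappa>1 where "\<kappa>1 = \<omega> * \<kappa>"
  define \<kappa>2 where "\<kappa>2 = \<omega>\<^sup>2 * \<kappa>"
  \<comment> \<open>These identities say that the coefficients of \<open>a\<close> and
    \<open>b\<close> cancel when the three first-order equations are composed, leaving only
    \<open>\<kappa> ^ 3\<close> in front of \<open>d\<close>.\<close>
  have s1: "\<kappa>2 + \<kappa>1 + \<kappa> = 0"
    using \<omega> by (simp add: \<kappa>1_def \<kappa>2_def) algebra
  have s2: "\<kappa>2\<^sup>2 + \<kappa>2 * \<kappa>1 + \<kappa>1\<^sup>2 = 0"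
    using \<omega> by (simp add: \<kappa>1_def \<kappa>2_def) algebra
  have s3: "\<kappa>2 ^ 3 = \<kappa> ^ 3"
    using \<omega> by (simp add: \<kappa>1_def \<kappa>2_def) algebra
  have Im: "Im \<omega> \<noteq> 0" "Im (\<omega>\<^sup>2) \<noteq> 0"
    by (simp_all add: \<omega>_def power2_eq_square)
  \<comment> \<open>Here \<kappa> is a nonzero imaginary number and multiplication by a nonreal cube
    root of unity gives it a real part, so the exponential cannot have modulus 1.\<close>
  have nonres: "expo \<kappa>1 1 \<noteq> 1" "expo \<kappa>2 1 \<noteq> 1" if "n \<noteq> 0"
  proof -
    have "Re \<kappa>1 \<noteq> 0" "Re \<kappa>2 \<noteq> 0"
      using that Im by (simp_all add: \<kappa>1_def \<kappa>2_def \<kappa>_def freq_def)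
    then have "norm (expo \<kappa>1 1) \<noteq> 1" "norm (expo \<kappa>2 1) \<noteq> 1"
      by (simp_all add: expo_def)
    then show "expo \<kappa>1 1 \<noteq> 1" "expo \<kappa>2 1 \<noteq> 1" by auto
  qed
  have res: "\<kappa> = 0" "\<kappa>1 = 0" "\<kappa>2 = 0" if "n = 0"
    using that by (simp_all add: \<kappa>_def \<kappa>1_def \<kappa>2_def)
  obtain A where A: "0 \<le> A" "\<And>g. integrable unit_meas g \<Longrightarrow>
      expo \<kappa> 1 \<noteq> 1 \<or> (LINT x|unit_meas. g x * expo (- \<kappa>) x) = 0 \<Longrightarrow>
      \<exists>w. periodic_antideriv w (\<lambda>x. \<kappa> * w x + g x) \<and>
        (\<forall>x\<in>{0..1}. norm (w x) \<le> A * (LINT x|unit_meas. norm (g x))) \<and>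
        (expo \<kappa> 1 = 1 \<longrightarrow> (LINT x|unit_meas. w x * expo (- \<kappa>) x) = 0)"
    by (rule periodic_first_order[of \<kappa>]) blast
  obtain A1 where A1: "0 \<le> A1" "\<And>g. integrable unit_meas g \<Longrightarrow>
      expo \<kappa>1 1 \<noteq> 1 \<or> (LINT x|unit_meas. g x * expo (- \<kappa>1) x) = 0 \<Longrightarrow>
      \<exists>w. periodic_antideriv w (\<lambda>x. \<kappa>1 * w x + g x) \<and>
        (\<forall>x\<in>{0..1}. norm (w x) \<le> A1 * (LINT x|unit_meas. norm (g x))) \<and>
        (expo \<kappa>1 1 = 1 \<longrightarrow> (LINT x|unit_meas. w x * expo (- \<kappa>1) x) = 0)"
    by (rule periodic_first_order[of \<kappa>1]) blast
  obtain A2 where A2: "0 \<le> A2" "\<And>g. integrable unit_meas g \<Longrightarrow>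
      expo \<kappa>2 1 \<noteq> 1 \<or> (LINT x|unit_meas. g x * expo (- \<kappa>2) x) = 0 \<Longrightarrow>
      \<exists>w. periodic_antideriv w (\<lambda>x. \<kappa>2 * w x + g x) \<and>
        (\<forall>x\<in>{0..1}. norm (w x) \<le> A2 * (LINT x|unit_meas. norm (g x))) \<and>
        (expo \<kappa>2 1 = 1 \<longrightarrow> (LINT x|unit_meas. w x * expo (- \<kappa>2) x) = 0)"
    by (rule periodic_first_order[of \<kappa>2]) blast
  show thesis
  proof (rule that[of "A2 * (A1 * A)"])
    show "0 \<le> A2 * (A1 * A)" using A A1 A2 by simp
    fix g assume g: "integrable unit_meas g" and orth: "(LINT x|unit_meas. g x * expo (- freq n) x) = 0"
    let ?G = "LINT x|unit_meas. norm (g x)"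
    \<comment> \<open>The factor with rate \<kappa> is always resonant and is solved at once, where
      the orthogonality of \<open>g\<close> is available. For \<open>n = 0\<close> all rates are 0,
      and the normalisation of each solution is the solvability condition for the next.\<close>
    obtain a where a: "periodic_antideriv a (\<lambda>x. \<kappa> * a x + g x)"
      "\<And>x. x \<in> {0..1} \<Longrightarrow> norm (a x) \<le> A * ?G" "(LINT x|unit_meas. a x * expo (- \<kappa>) x) = 0"
      using A(2)[OF g] orth by (auto simp: \<kappa>_def)
    note ca = periodic_antideriv_continuous[OF a(1)]
    have "expo \<kappa>1 1 \<noteq> 1 \<or> (LINT x|unit_meas. a x * expo (- \<kappa>1) x) = 0"
      using nonres(1) a(3) res by (cases "n = 0") auto
    from A1(2)[OF integrable_continuous_unit_meas[OF ca] this]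
    obtain b where b: "periodic_antideriv b (\<lambda>x. \<kappa>1 * b x + a x)"
      "\<And>x. x \<in> {0..1} \<Longrightarrow> norm (b x) \<le> A1 * (LINT x|unit_meas. norm (a x))"
      "expo \<kappa>1 1 = 1 \<longrightarrow> (LINT x|unit_meas. b x * expo (- \<kappa>1) x) = 0"
      by blast
    note cb = periodic_antideriv_continuous[OF b(1)]
    have "expo \<kappa>2 1 \<noteq> 1 \<or> (LINT x|unit_meas. b x * expo (- \<kappa>2) x) = 0"
      using nonres(2) b(3) res by (cases "n = 0") auto
    from A2(2)[OF integrable_continuous_unit_meas[OF cb] this]
    obtain d where d: "periodic_antideriv d (\<lambda>x. \<kappa>2 * d x + b x)"
      "\<And>x. x \<in> {0..1} \<Longrightarrow> norm (d x) \<le> A2 * (LINT x|unit_meas. norm (b x))"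
      by blast
    \<comment> \<open>\<open>w1\<close> and \<open>w2\<close> are the first and second derivatives
      of the final solution \<open>d\<close>.\<close>
    define w1 where "w1 x = \<kappa>2 * d x + b x" for x
    define w2 where "w2 x = \<kappa>2 * w1 x + (\<kappa>1 * b x + a x)" for x
    have 0: "periodic_antideriv d w1"
      using d(1) by (simp add: w1_def[abs_def])
    have 1: "periodic_antideriv w1 w2"
      unfolding w1_def[abs_def] w2_def[abs_def]
      by (intro periodic_antideriv_add periodic_antideriv_cmult d(1) b(1))
    have "periodic_antideriv (\<lambda>x. \<kappa>2 * w1 x + (\<kappa>1 * b x + a x))
        (\<lambda>x. \<kappa>2 * w2 x + (\<kappa>1 * (\<kappa>1 * b x + a x) + (\<kappa> * a x + g x)))"
      by (intro periodic_antideriv_add periodic_antideriv_cmult 1 b(1) a(1))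
    also have "(\<lambda>x. \<kappa>2 * w1 x + (\<kappa>1 * b x + a x)) = w2"
      by (simp add: w2_def[abs_def])
    also have "(\<lambda>x. \<kappa>2 * w2 x + (\<kappa>1 * (\<kappa>1 * b x + a x) + (\<kappa> * a x + g x))) = (\<lambda>x. freq n ^ 3 * d x + g x)"
    proof
      fix x
      have "\<kappa>2 * w2 x + (\<kappa>1 * (\<kappa>1 * b x + a x) + (\<kappa> * a x + g x)) =
          \<kappa>2 ^ 3 * d x + (\<kappa>2\<^sup>2 + \<kappa>2 * \<kappa>1 + \<kappa>1\<^sup>2) * b x + (\<kappa>2 + \<kappa>1 + \<kappa>) * a x + g x"
        by (simp add: w1_def w2_def algebra_simps power2_eq_square power3_eq_cube)
      then show "\<kappa>2 * w2 x + (\<kappa>1 * (\<kappa>1 * b x + a x) + (\<kappa> * a x + g x)) = freq n ^ 3 * d x + g x"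
        unfolding s1 s2 s3 by (simp add: \<kappa>_def)
    qed
    finally have 2: "periodic_antideriv w2 (\<lambda>x. freq n ^ 3 * d x + g x)" .
    have "norm (d x) \<le> A2 * (A1 * A) * ?G" if x: "x \<in> {0..1}" for x
    proof -
      have "(LINT x|unit_meas. norm (a x)) \<le> A * ?G"
        by (rule integral_norm_le_bound[OF ca a(2)])
      then have "A1 * (LINT x|unit_meas. norm (a x)) \<le> A1 * (A * ?G)"
        by (rule mult_left_mono[OF _ A1(1)])
      moreover have "(LINT x|unit_meas. norm (b x)) \<le> A1 * (LINT x|unit_meas. norm (a x))"
        by (rule integral_norm_le_bound[OF cb b(2)])
      ultimately have "(LINT x|unit_meas. norm (b x)) \<le> A1 * (A * ?G)"
        by linarith
      then have "A2 * (LINT x|unit_meas. norm (b x)) \<le> A2 * (A1 * (A * ?G))"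
        by (rule mult_left_mono[OF _ A2(1)])
      with d(2)[OF x] show ?thesis by (simp add: mult.assoc)
    qed
    with 0 1 2 show "\<exists>w0 w1 w2. periodic_antideriv w0 w1 \<and> periodic_antideriv w1 w2 \<and>
        periodic_antideriv w2 (\<lambda>x. freq n ^ 3 * w0 x + g x) \<and>
        (\<forall>x\<in>{0..1}. norm (w0 x) \<le> A2 * (A1 * A) * ?G)"
      by blast
  qed
qed

section \<open>Spectra\<close>

lemma ip_cong_AE:
  assumes "y \<in> L2" "u \<in> L2" "v \<in> L2" "ae_eq y u"
  shows "ip y v = ip u v"
  unfolding ip_def
  using assms(4) by (intro integral_cong_AE borel_measurable_integrable L2_integrable_mult assms)
    (auto simp: ae_eq_def elim: eventually_mono)

lemma ip_add:
  assumes "y \<in> L2" "u \<in> L2" "v \<in> L2"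
  shows "ip (\<lambda>x. y x + u x) v = ip y v + ip u v"
  unfolding ip_def
  using L2_integrable_mult[OF assms(1,3)] L2_integrable_mult[OF assms(2,3)] by (simp add: distrib_right)

lemma ip_cmult: "ip (\<lambda>x. c * y x) v = c * ip y v"
  unfolding ip_def by (simp add: mult.assoc)

lemma cnj_ip: "cnj (ip f g) = ip g f"
  unfolding ip_def by (subst Bochner_Integration.integral_cnj[symmetric]) (simp add: mult.commute del: Bochner_Integration.integral_cnj)

lemma L2norm_cong_AE:
  assumes "y \<in> L2" "u \<in> L2" "ae_eq y u"
  shows "L2norm y = L2norm u"
proof -
  have "(LINT x|unit_meas. (norm (y x))\<^sup>2) = (LINT x|unit_meas. (norm (u x))\<^sup>2)"
    using assms by (intro integral_cong_AE borel_measurable_integrable L2_integrable_square)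
      (auto simp: ae_eq_def elim: eventually_mono)
  then show ?thesis by (simp add: L2norm_def)
qed

lemma expo_L2: "expo \<kappa> \<in> L2"
  by (intro continuous_L2 continuous_intros)

lemma ip_expo: "ip f (expo (freq k)) = (LINT x|unit_meas. f x * expo (- freq k) x)"
  by (simp add: ip_def)

lemma norm_ip_le:
  assumes w: "continuous_on {0..1} w" "\<And>x. x \<in> {0..1} \<Longrightarrow> norm (w x) \<le> B" and v: "v \<in> L2"
  shows "norm (ip w v) \<le> B * (LINT x|unit_meas. norm (v x))"
proof -
  have "norm (ip w v) \<le> (LINT x|unit_meas. norm (w x * cnj (v x)))"
    unfolding ip_def by (rule integral_norm_bound)
  also have "\<dots> = (LINT x|unit_meas. norm (v x * w x))"
    by (simp add: norm_mult mult.commute)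
  also have "\<dots> \<le> B * (LINT x|unit_meas. norm (v x))"
    by (rule norm_integral_mult_le[OF L2_integrable[OF v] w])
  finally show ?thesis .
qed

lemma norm_ip_expo_le: "norm (ip f (expo (freq k))) \<le> (LINT x|unit_meas. norm (f x))"
proof -
  have "norm (expo (- freq k) x) = 1" for x
    using norm_expo_freq[of "- k"] by (simp add: freq_minus)
  then show ?thesis
    using integral_norm_bound[of unit_meas "\<lambda>x. f x * expo (- freq k) x"]
    by (simp add: ip_expo norm_mult)
qed

lemma fourier_coeffs_zero:
  assumes f: "f \<in> L2" and 0: "\<And>k. ip f (expo (freq k)) = 0"
  shows "ae_eq f (\<lambda>x. 0)"
  unfolding ae_eq_def
proof (rule fourier_complete[OF L2_integrable[OF f]])
  fix k show "(LINT x|unit_meas. f x * expo (freq k) x) = 0"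
    using 0[of "- k"] ip_expo[of f "- k"] by (simp add: freq_minus)
qed

text \<open>Integrating the derivative of the periodic function \<open>expo (freq (n - k))\<close>
  gives zero, so \<open>freq (n - k)\<close> times the integral vanishes.\<close>

lemma ip_expo_expo: "ip (expo (freq n)) (expo (freq k)) = (if n = k then 1 else 0)"
proof -
  have eq: "ip (expo (freq n)) (expo (freq k)) = (LINT x|unit_meas. expo (freq (n - k)) x)"
    using freq_add[of n "- k"] by (simp add: ip_expo freq_minus flip: expo_add)
  have "antideriv (expo (freq (n - k))) (\<lambda>x. freq (n - k) * expo (freq (n - k)) x)"
    by (intro antideriv_C1 expo_deriv continuous_intros)
  from antideriv_integral[OF this] have "freq (n - k) * (LINT x|unit_meas. expo (freq (n - k)) x) = 0"
    by simp
  then show ?thesis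
    unfolding eq by (cases "n = k") (simp_all add: freq_def)
qed

text \<open>Integration by parts against the conjugate exponential; periodicity of both factors
  cancels the boundary terms.\<close>

lemma ip_periodic_antideriv:
  assumes "periodic_antideriv w u"
  shows "ip u (expo (freq k)) = freq k * ip w (expo (freq k))"
proof -
  have w: "antideriv w u" "w 1 = w 0" using assms by (auto simp: periodic_antideriv_def)
  have i: "integrable unit_meas (\<lambda>x. u x * expo (- freq k) x)"
    "integrable unit_meas (\<lambda>x. w x * expo (- freq k) x)"
    by (intro integrable_mult_continuous[OF antideriv_integrable[OF w(1)]] continuous_intros
        integrable_continuous_unit_meas antideriv_continuous[OF w(1)])+
  have "antideriv (\<lambda>x. w x * expo (- freq k) x) (\<lambda>x. u x * expo (- freq k) x + w x * (- freq k * expo (- freq k) x))"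
    by (rule antideriv_mult[OF w(1) expo_deriv]) (intro continuous_intros)
  from antideriv_integral[OF this] w(2)
  have "0 = (LINT x|unit_meas. u x * expo (- freq k) x + (- freq k) * (w x * expo (- freq k) x))"
    by (simp add: mult_ac)
  also have "\<dots> = (LINT x|unit_meas. u x * expo (- freq k) x) + (- freq k) * (LINT x|unit_meas. w x * expo (- freq k) x)"
    using i by (subst Bochner_Integration.integral_add) auto
  finally show ?thesis by (simp add: ip_expo)
qed

section \<open>Fourier coefficients and eigenfunctions of the operators\<close>

lemma dom_L_L2: "y \<in> dom_L \<Longrightarrow> y \<in> L2"
  by (simp add: dom_L_def sobolev_def)

lemma ip_weak_deriv_3:
  assumes "y \<in> dom_L"
  shows "ip (weak_deriv 3 y) (expo (freq k)) = freq k ^ 3 * ip y (expo (freq k))"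
proof -
  from assms obtain w0 w1 w2 where w: "ae_eq y w0" "periodic_antideriv w0 w1" "periodic_antideriv w1 w2"
    "periodic_antideriv w2 (weak_deriv 3 y)"
    by (rule dom_L_E)
  have "ip y (expo (freq k)) = ip w0 (expo (freq k))"
    by (intro ip_cong_AE dom_L_L2 assms expo_L2 w continuous_L2 periodic_antideriv_continuous[OF w(2)])
  then show ?thesis
    using w(2-4)[THEN ip_periodic_antideriv, of k] by (simp add: power3_eq_cube)
qed

lemma weak_deriv_3_L2: "y \<in> dom_L \<Longrightarrow> weak_deriv 3 y \<in> L2"
  by (erule dom_L_E)

lemma expo_dom_L:
  "expo (freq n) \<in> dom_L" "ae_eq (weak_deriv 3 (expo (freq n))) (\<lambda>x. freq n ^ 3 * expo (freq n) x)"
proof -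
  have p: "periodic_antideriv (expo (freq n)) (\<lambda>x. freq n * expo (freq n) x)"
    unfolding periodic_antideriv_def by (auto intro!: antideriv_C1 expo_deriv continuous_intros)
  note p' = periodic_antideriv_cmult[OF p]
  have "periodic_antideriv (\<lambda>x. freq n * expo (freq n) x) (\<lambda>x. freq n ^ 2 * expo (freq n) x)"
    "periodic_antideriv (\<lambda>x. freq n ^ 2 * expo (freq n) x) (\<lambda>x. freq n ^ 3 * expo (freq n) x)"
    using p'[of "freq n"] p'[of "freq n ^ 2"] by (simp_all add: power2_eq_square power3_eq_cube mult.assoc)
  from dom_L_I[OF p this L2_cmult[OF expo_L2]]
  show "expo (freq n) \<in> dom_L" "ae_eq (weak_deriv 3 (expo (freq n))) (\<lambda>x. freq n ^ 3 * expo (freq n) x)" .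
qed

lemma zero_dom_L: "(\<lambda>x. 0) \<in> dom_L" "ae_eq (weak_deriv 3 (\<lambda>x. 0)) (\<lambda>x. 0)"
proof -
  have "periodic_antideriv (\<lambda>x. 0) (\<lambda>x. 0)"
    unfolding periodic_antideriv_def antideriv_def by (simp add: prim_def)
  from dom_L_I[OF this this this] show "(\<lambda>x. 0) \<in> dom_L" "ae_eq (weak_deriv 3 (\<lambda>x. 0)) (\<lambda>x. 0)"
    by (auto simp: L2_def)
qed

text \<open>It is the injectivity clause that fails: the eigenfunction and the zero function have
  the same image but are not almost everywhere equal.\<close>

lemma eigenvalue_in_spectrum_L_zero: "\<i> * freq n ^ 3 \<in> spectrum dom_L L_zero"
proof -
  have "ae_eq (\<lambda>x. L_zero (expo (freq n)) x - \<i> * freq n ^ 3 * expo (freq n) x)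
      (\<lambda>x. L_zero (\<lambda>x. 0) x - \<i> * freq n ^ 3 * 0)"
    using expo_dom_L(2)[of n] zero_dom_L(2) unfolding ae_eq_def L_zero_def
    by eventually_elim simp
  moreover have "\<not> ae_eq (expo (freq n)) (\<lambda>x. 0)"
  proof
    assume "ae_eq (expo (freq n)) (\<lambda>x. 0)"
    then have "ip (expo (freq n)) (expo (freq n)) = ip (\<lambda>x. 0) (expo (freq n))"
      by (intro ip_cong_AE expo_L2 dom_L_L2 zero_dom_L)
    then show False by (simp add: ip_expo_expo ip_def[of "\<lambda>x. 0"])
  qed
  ultimately show ?thesis
    using expo_dom_L(1)[of n] zero_dom_L(1) unfolding spectrum_def resolvent_set_def by blast
qed

lemma ip_L_op_shift:
  assumes y: "y \<in> dom_L" and v: "v \<in> L2"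
  shows "ip (\<lambda>x. L_op \<alpha> v y x - z * y x) (expo (freq k)) =
    (\<i> * freq k ^ 3 - z) * ip y (expo (freq k)) + \<alpha> * ip y v * ip v (expo (freq k))"
proof -
  have "ip (\<lambda>x. L_op \<alpha> v y x - z * y x) (expo (freq k)) =
      ip (\<lambda>x. (\<i> * weak_deriv 3 y x + (\<alpha> * ip y v) * v x) + (- z) * y x) (expo (freq k))"
    by (simp add: L_op_def)
  also have "\<dots> = \<i> * ip (weak_deriv 3 y) (expo (freq k)) + \<alpha> * ip y v * ip v (expo (freq k))
      + (- z) * ip y (expo (freq k))"
    by (subst ip_add | intro L2_add L2_cmult weak_deriv_3_L2 dom_L_L2 y v expo_L2 | subst ip_cmult)+ simp
  finally show ?thesis
    by (simp add: ip_weak_deriv_3[OF y] algebra_simps)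
qed

lemma L_op_shift_L2:
  assumes "y \<in> dom_L" "v \<in> L2"
  shows "(\<lambda>x. L_op \<alpha> v y x - z * y x) \<in> L2"
proof -
  have "(\<lambda>x. (\<i> * weak_deriv 3 y x + (\<alpha> * ip y v) * v x) + (- z) * y x) \<in> L2"
    by (intro L2_add L2_cmult weak_deriv_3_L2 dom_L_L2 assms)
  then show ?thesis by (simp add: L_op_def)
qed

text \<open>Cubing is not injective on complex numbers; here both cubes are the same multiple of
  real cubes, and an odd power is injective on the reals.\<close>

lemma freq_cube_inj: "freq k ^ 3 = freq n ^ 3 \<Longrightarrow> k = n"
proof -
  assume "freq k ^ 3 = freq n ^ 3"
  then have "complex_of_real ((2 * pi * of_int k) ^ 3) = complex_of_real ((2 * pi * of_int n) ^ 3)"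
    by (simp add: freq_def power_mult_distrib)
  then have "(2 * pi * of_int k) ^ 3 = (2 * pi * of_int n) ^ 3"
    by (simp only: of_real_eq_iff)
  then have "2 * pi * of_int k = 2 * pi * of_int n"
    by (metis odd_numeral odd_real_root_power_cancel)
  then show "k = n" by simp
qed

text \<open>Two elements are compared coefficient by coefficient instead of through a trivial
  kernel: \<open>weak_deriv\<close> picks representatives, so the operator respects differences only
  up to null sets.\<close>

lemma L_op_shift_inj:
  fixes \<alpha> :: real
  assumes "\<alpha> \<noteq> 0" and v: "v \<in> L2" and vn: "ip v (expo (freq n)) \<noteq> 0"
    and y: "y \<in> dom_L" and u: "u \<in> dom_L"
    and eq: "ae_eq (\<lambda>x. L_op \<alpha> v y x - \<i> * freq n ^ 3 * y x) (\<lambda>x. L_op \<alpha> v u x - \<i> * freq n ^ 3 * u x)"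
  shows "ae_eq y u"
proof -
  note yL = dom_L_L2[OF y] and uL = dom_L_L2[OF u]
  have coeff: "(\<i> * freq k ^ 3 - \<i> * freq n ^ 3) * ip y (expo (freq k)) + \<alpha> * ip y v * ip v (expo (freq k)) =
      (\<i> * freq k ^ 3 - \<i> * freq n ^ 3) * ip u (expo (freq k)) + \<alpha> * ip u v * ip v (expo (freq k))" for k
    using ip_cong_AE[OF L_op_shift_L2[OF y v] L_op_shift_L2[OF u v] expo_L2 eq, of "freq k"]
    unfolding ip_L_op_shift[OF y v] ip_L_op_shift[OF u v] .
  \<comment> \<open>At \<open>k = n\<close> the eigenvalue factor is zero and only the rank-one term
    survives.\<close>
  have yv: "ip y v = ip u v"
    using coeff[of n] \<open>\<alpha> \<noteq> 0\<close> vn by simp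
  \<comment> \<open>The rank-one terms now agree, and for \<open>k \<noteq> n\<close> the remaining
    factor is nonzero because the eigenvalues are distinct.\<close>
  have off: "ip y (expo (freq k)) = ip u (expo (freq k))" if "k \<noteq> n" for k
    using coeff[of k] yv freq_cube_inj[of k n] that by auto
  define c where "c = ip y (expo (freq n)) - ip u (expo (freq n))"
  let ?d = "\<lambda>x. (y x + (- 1) * u x) + (- c) * expo (freq n) x"
  have "ip ?d (expo (freq k)) = 0" for k
  proof -
    have "ip ?d (expo (freq k)) = ip y (expo (freq k)) + (- 1) * ip u (expo (freq k)) +
        (- c) * ip (expo (freq n)) (expo (freq k))"
      by (subst ip_add | intro L2_add L2_cmult yL uL expo_L2 | subst ip_cmult)+ simp
    then show ?thesis
      using off[of k] by (auto simp: ip_expo_expo c_def)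
  qed
  then have "ae_eq ?d (\<lambda>x. 0)"
    by (intro fourier_coeffs_zero L2_add L2_cmult yL uL expo_L2)
  then have d: "ae_eq y (\<lambda>x. u x + c * expo (freq n) x)"
    unfolding ae_eq_def by eventually_elim (simp add: algebra_simps)
  then have "ip y v = ip (\<lambda>x. u x + c * expo (freq n) x) v"
    by (intro ip_cong_AE L2_add L2_cmult yL uL v expo_L2)
  also have "\<dots> = ip u v + c * ip (expo (freq n)) v"
    by (subst ip_add | intro L2_cmult uL expo_L2 v | subst ip_cmult)+ simp
  finally have "c * cnj (ip v (expo (freq n))) = 0"
    using yv by (simp add: cnj_ip)
  then have "c = 0" using vn by simp
  with d show ?thesis by simp
qed

text \<open>The bound is proved for the solution that is constructed, with one constant for all
  \<open>f\<close>; injectivity later extends it to every element of the domain.\<close>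

lemma L_op_shift_surj:
  fixes \<alpha> :: real
  assumes "\<alpha> \<noteq> 0" and v: "v \<in> L2" and vn: "ip v (expo (freq n)) \<noteq> 0"
  obtains C where "\<And>f. f \<in> L2 \<Longrightarrow> \<exists>y\<in>dom_L.
    ae_eq (\<lambda>x. L_op \<alpha> v y x - \<i> * freq n ^ 3 * y x) f \<and> L2norm y \<le> C * L2norm f"
proof -
  obtain A where A: "0 \<le> A" "\<And>g. integrable unit_meas g \<Longrightarrow>
      (LINT x|unit_meas. g x * expo (- freq n) x) = 0 \<Longrightarrow>
      \<exists>w0 w1 w2. periodic_antideriv w0 w1 \<and> periodic_antideriv w1 w2 \<and>
        periodic_antideriv w2 (\<lambda>x. freq n ^ 3 * w0 x + g x) \<and>
        (\<forall>x\<in>{0..1}. norm (w0 x) \<le> A * (LINT x|unit_meas. norm (g x)))"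
    by (rule periodic_third_order[of n]) blast
  define e where "e = expo (freq n)"
  define vn where "vn = ip v e"
  have vn0: "vn \<noteq> 0" using vn by (simp add: vn_def e_def)
  define V where "V = (LINT x|unit_meas. norm (v x))"
  have V: "0 \<le> V" by (simp add: V_def)
  \<comment> \<open>Relative to the L^1 norm \<open>F\<close> of the data: \<open>K1\<close> bounds
    the L^1 norm of \<open>g\<close>, \<open>K2\<close> the sup norm of \<open>w0\<close>, and
    \<open>K3\<close> the coefficient \<open>c\<close> of the eigenfunction.\<close>
  define K1 where "K1 = 1 + V / norm vn"
  define K2 where "K2 = A * K1"
  define K3 where "K3 = (1 / (\<bar>\<alpha>\<bar> * norm vn) + K2 * V) / norm vn"
  have K: "0 \<le> K1" "0 \<le> K2" "0 \<le> K3"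
    using A V by (simp_all add: K1_def K2_def K3_def)
  have eL: "e \<in> L2" and ce: "continuous_on {0..1} e"
    by (auto simp: e_def intro!: expo_L2 continuous_intros)
  show thesis
  proof (rule that[of "K2 + K3"])
    fix f assume f: "f \<in> L2"
    define F where "F = (LINT x|unit_meas. norm (f x))"
    \<comment> \<open>The value that \<open>ip y v\<close> is forced to take.\<close>
    define s where "s = ip f e / (\<alpha> * vn)"
    have s: "\<alpha> * s * vn = ip f e"
      using \<open>\<alpha> \<noteq> 0\<close> vn0 by (simp add: s_def)
    have ns: "norm s \<le> 1 / (\<bar>\<alpha>\<bar> * norm vn) * F"
      using norm_ip_expo_le[of f n] by (simp add: s_def e_def F_def norm_divide norm_mult divide_right_mono)
    \<comment> \<open>Multiplying by \<open>- \<i>\<close> brings the equation with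
      \<open>ip y v = s\<close> into the form \<open>y''' = freq n ^ 3 * y + g\<close>.\<close>
    define g where "g x = (- \<i>) * f x + (\<i> * (\<alpha> * s)) * v x" for x
    have gL: "g \<in> L2"
      unfolding g_def by (intro L2_add L2_cmult f v)
    have "ip g e = (- \<i>) * ip f e + (\<i> * (\<alpha> * s)) * ip v e"
      unfolding g_def by (subst ip_add | intro L2_cmult f v eL | subst ip_cmult)+ simp
    then have orth: "ip g e = 0"
      using s by (simp add: vn_def mult.assoc)
    have "(LINT x|unit_meas. norm (g x)) \<le> (LINT x|unit_meas. norm (f x) + norm (\<alpha> * s) * norm (v x))"
    proof (rule integral_mono)
      show "integrable unit_meas (\<lambda>x. norm (g x))"
        "integrable unit_meas (\<lambda>x. norm (f x) + norm (\<alpha> * s) * norm (v x))"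
        by (intro Bochner_Integration.integrable_add Bochner_Integration.integrable_norm
            integrable_mult_right L2_integrable gL f v)+
      show "norm (g x) \<le> norm (f x) + norm (\<alpha> * s) * norm (v x)" for x
        unfolding g_def using norm_triangle_ineq[of "(- \<i>) * f x" "(\<i> * (\<alpha> * s)) * v x"]
        by (simp add: norm_mult)
    qed
    also have "\<dots> = F + norm (\<alpha> * s) * V"
      using f v by (simp add: F_def V_def L2_integrable)
    also have "norm (\<alpha> * s) * V \<le> F / norm vn * V"
    proof (rule mult_right_mono[OF _ V])
      have "norm (\<alpha> * s) = norm (ip f e) / norm vn"
        using \<open>\<alpha> \<noteq> 0\<close> by (simp add: s_def norm_mult norm_divide)
      then show "norm (\<alpha> * s) \<le> F / norm vn"
        using norm_ip_expo_le[of f n] by (simp add: e_def F_def divide_right_mono)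
    qed
    finally have ng: "(LINT x|unit_meas. norm (g x)) \<le> K1 * F"
      by (simp add: K1_def algebra_simps)
    obtain w0 w1 w2 where w: "periodic_antideriv w0 w1" "periodic_antideriv w1 w2"
        "periodic_antideriv w2 (\<lambda>x. freq n ^ 3 * w0 x + g x)"
      and w0: "\<forall>x\<in>{0..1}. norm (w0 x) \<le> A * (LINT x|unit_meas. norm (g x))"
      using A(2)[OF L2_integrable[OF gL]] orth by (auto simp: e_def ip_expo)
    note cw = periodic_antideriv_continuous[OF w(1)]
    have nw: "norm (w0 x) \<le> K2 * F" if "x \<in> {0..1}" for x
      using w0 that mult_left_mono[OF ng A(1)] unfolding K2_def mult.assoc by force
    \<comment> \<open>Adding a multiple of \<open>e\<close> keeps the differential equation intact,
      and this multiple adjusts the pairing with \<open>v\<close> from \<open>ip w0 v\<close> to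
      \<open>s\<close>.\<close>
    define c where "c = (s - ip w0 v) / cnj vn"
    have "norm (ip w0 v) \<le> K2 * F * V"
      unfolding V_def by (rule norm_ip_le[OF cw nw v])
    then have "norm (s - ip w0 v) \<le> (1 / (\<bar>\<alpha>\<bar> * norm vn) + K2 * V) * F"
      using ns norm_triangle_ineq4[of s "ip w0 v"] by (simp add: algebra_simps)
    then have nc: "norm c \<le> K3 * F"
      unfolding c_def K3_def norm_divide complex_mod_cnj times_divide_eq_left
      by (rule divide_right_mono) simp
    define y where "y x = w0 x + c * e x" for x
    have p: "periodic_antideriv e (\<lambda>x. freq n * e x)"
      unfolding e_def periodic_antideriv_def by (auto intro!: antideriv_C1 expo_deriv continuous_intros)
    have p2: "periodic_antideriv (\<lambda>x. freq n * e x) (\<lambda>x. freq n ^ 2 * e x)"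
      and p3: "periodic_antideriv (\<lambda>x. freq n ^ 2 * e x) (\<lambda>x. freq n ^ 3 * e x)"
      using periodic_antideriv_cmult[OF p, of "freq n"] periodic_antideriv_cmult[OF p, of "freq n ^ 2"]
      by (simp_all add: power2_eq_square power3_eq_cube mult.assoc)
    note y3 = dom_L_I[OF periodic_antideriv_add[OF w(1) periodic_antideriv_cmult[OF p, of c]]
        periodic_antideriv_add[OF w(2) periodic_antideriv_cmult[OF p2, of c]]
        periodic_antideriv_add[OF w(3) periodic_antideriv_cmult[OF p3, of c]], folded y_def]
    have rhs: "(\<lambda>x. freq n ^ 3 * w0 x + g x + c * (freq n ^ 3 * e x)) \<in> L2"
      by (intro L2_add L2_cmult gL eL continuous_L2[OF cw])
    have yD: "y \<in> dom_L"
      using y3(1)[OF rhs] by (simp add: y_def[abs_def])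
    have yw: "ae_eq (weak_deriv 3 y) (\<lambda>x. freq n ^ 3 * w0 x + g x + c * (freq n ^ 3 * e x))"
      using y3(2)[OF rhs] by (simp add: y_def[abs_def])
    have "ip y v = ip w0 v + c * ip e v"
      unfolding y_def by (subst ip_add | intro L2_cmult v eL continuous_L2[OF cw] | subst ip_cmult)+ simp
    moreover have "ip e v = cnj vn"
      by (simp add: vn_def cnj_ip)
    ultimately have yv: "ip y v = s"
      using vn0 by (simp add: c_def)
    have "ae_eq (\<lambda>x. L_op \<alpha> v y x - \<i> * freq n ^ 3 * y x) f"
      using yw unfolding ae_eq_def L_op_def yv
    proof eventually_elim
      case (elim x)
      show ?case
        unfolding elim y_def g_def by (simp add: algebra_simps)
    qed
    moreover have "L2norm y \<le> (K2 + K3) * L2norm f"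
    proof -
      have "norm (y x) \<le> (K2 + K3) * F" if "x \<in> {0..1}" for x
        using norm_triangle_ineq[of "w0 x" "c * e x"] nw[OF that] nc
        by (simp add: y_def e_def norm_mult algebra_simps)
      then have "L2norm y \<le> (K2 + K3) * F"
        unfolding y_def by (intro L2norm_le_bound continuous_intros cw ce)
      also have "\<dots> \<le> (K2 + K3) * L2norm f"
        using integral_norm_le_L2norm[OF f] K unfolding F_def by (intro mult_left_mono) auto
      finally show ?thesis .
    qed
    ultimately show "\<exists>y\<in>dom_L. ae_eq (\<lambda>x. L_op \<alpha> v y x - \<i> * freq n ^ 3 * y x) f \<and>
        L2norm y \<le> (K2 + K3) * L2norm f"
      using yD by blast
  qed
qed

text \<open>To bound an arbitrary \<open>y\<close>, the equation is solved again with the image of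
  \<open>y\<close> as right-hand side; injectivity identifies the bounded solution with
  \<open>y\<close>.\<close>

lemma eigenvalue_in_resolvent_set_L_op:
  fixes \<alpha> :: real
  assumes "\<alpha> \<noteq> 0" "v \<in> L2" "ip v (expo (freq n)) \<noteq> 0"
  shows "\<i> * freq n ^ 3 \<in> resolvent_set dom_L (L_op \<alpha> v)"
proof -
  obtain C where C: "\<And>f. f \<in> L2 \<Longrightarrow> \<exists>y\<in>dom_L.
    ae_eq (\<lambda>x. L_op \<alpha> v y x - \<i> * freq n ^ 3 * y x) f \<and> L2norm y \<le> C * L2norm f"
    by (rule L_op_shift_surj[OF assms]) blast
  have "L2norm y \<le> C * L2norm (\<lambda>x. L_op \<alpha> v y x - \<i> * freq n ^ 3 * y x)" if y: "y \<in> dom_L" for y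
  proof -
    obtain u where u: "u \<in> dom_L"
      "ae_eq (\<lambda>x. L_op \<alpha> v u x - \<i> * freq n ^ 3 * u x) (\<lambda>x. L_op \<alpha> v y x - \<i> * freq n ^ 3 * y x)"
      "L2norm u \<le> C * L2norm (\<lambda>x. L_op \<alpha> v y x - \<i> * freq n ^ 3 * y x)"
      using C[OF L_op_shift_L2[OF y assms(2)]] by blast
    have "ae_eq u y"
      by (rule L_op_shift_inj[OF assms u(1) y u(2)])
    with u show ?thesis
      using L2norm_cong_AE[OF dom_L_L2 dom_L_L2] y by metis
  qed
  then show ?thesis
    unfolding resolvent_set_def using L_op_shift_inj[OF assms] C by blast
qed

theorem theorem5p1:
  fixes \<alpha> :: real and v :: "real \<Rightarrow> complex"
  assumes "\<alpha> \<noteq> 0"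
    and "v \<in> L2"
    and "spectrum dom_L (L_op \<alpha> v) = spectrum dom_L L_zero"
  shows "ae_eq v (\<lambda>x. 0)"
proof (rule fourier_coeffs_zero[OF assms(2)])
  fix n
  show "ip v (expo (freq n)) = 0"
    using eigenvalue_in_spectrum_L_zero[of n] eigenvalue_in_resolvent_set_L_op[OF assms(1,2), of n] assms(3)
    unfolding spectrum_def by blast
qed

end
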